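(* Let $m\ge 1$ and $\epsilon>0$. For every instance of the online scheduling problem on $m$ identical machines described in the context, the total flow time $\sum_{i}(C_i^S-r_i)$ of the schedule produced by $\mathrm{SRPT}$ running on $m$ machines of speed $1+\epsilon$ is at most $\frac{4}{\epsilon}$ times the minimum possible total flow time $\sum_i (C_i-r_i)$ achievable by any (offline) schedule of the same instance on $m$ machines of speed $1$. That is, $\mathrm{SRPT}$ is $(1+\epsilon)$-speed $\frac{4}{\epsilon}$-competitive for average flow time on $m$ identical parallel machines.
   Context: Problem: $n$ jobs $J_1,\dots,J_n$ arrive online; job $J_i$ is released at time $r_i\ge 0$ and has processing time $p_i>0$, both unknown before time $r_i$. There are $m$ identical machines. A schedule assigns, at each time, each machine to at most one alive job and each job to at most one machine; preemption and migration of jobs between machines are allowed. A machine of speed $s$ processes $s$ units of work per unit of time. The completion time $C_i$ of $J_i$ is the earliest time $t$ by which $p_i$ units of work have been done on $J_i$ during $(r_i,t]$; its flow time is $C_i-r_i$. The algorithm $\mathrm{SRPT}$ (Shortest Remaining Processing Time) on $m$ machines: at every time, among the released uncompleted jobs, it processes the (at most) $m$ jobs with the least remaining processing time, one per machine, breaking ties arbitrarily. $C_i^S$ denotes the completion time of $J_i$ under $\mathrm{SRPT}$. An algorithm is $s$-speed $c$-competitive if on every instance its objective with machines of speed $s$ is at most $c$ times the optimal objective with $m$ machines of speed $1$. *)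

theory Defs
  imports "HOL-Analysis.Analysis"
begin

text \<open>
  An instance consists of the jobs \<open>0, \<dots>, n - 1\<close> with release times \<open>r\<close> and processing
  times \<open>p\<close>.  The machines are \<open>0, \<dots>, m - 1\<close>.
\<close>

definition is_instance :: "nat \<Rightarrow> (nat \<Rightarrow> real) \<Rightarrow> (nat \<Rightarrow> real) \<Rightarrow> bool" where
  "is_instance n r p \<longleftrightarrow> (\<forall>i<n. 0 \<le> r i \<and> 0 < p i)"

text \<open>
  \<open>S t k = Some i\<close> means that machine \<open>k\<close> processes job \<open>i\<close> at time \<open>t\<close>; \<open>S t k = None\<close> means
  that it idles.  Values at machines \<open>k \<ge> m\<close> are ignored.
\<close>

type_synonym schedule = "real \<Rightarrow> nat \<Rightarrow> nat option"

definition processed :: "nat \<Rightarrow> schedule \<Rightarrow> real \<Rightarrow> nat set" where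
  "processed m S t = {i. \<exists>k<m. S t k = Some i}"

definition work_done :: "nat \<Rightarrow> real \<Rightarrow> (nat \<Rightarrow> real) \<Rightarrow> schedule \<Rightarrow> nat \<Rightarrow> real \<Rightarrow> real" where
  "work_done m s r S i t = s * measure lebesgue {x \<in> {r i<..t}. i \<in> processed m S x}"

definition remaining ::
  "nat \<Rightarrow> real \<Rightarrow> (nat \<Rightarrow> real) \<Rightarrow> (nat \<Rightarrow> real) \<Rightarrow> schedule \<Rightarrow> nat \<Rightarrow> real \<Rightarrow> real" where
  "remaining m s r p S i t = p i - work_done m s r S i t"

definition alive ::
  "nat \<Rightarrow> real \<Rightarrow> nat \<Rightarrow> (nat \<Rightarrow> real) \<Rightarrow> (nat \<Rightarrow> real) \<Rightarrow> schedule \<Rightarrow> real \<Rightarrow> nat set" where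
  "alive m s n r p S t = {i. i < n \<and> r i \<le> t \<and> 0 < remaining m s r p S i t}"

text \<open>
  Preemption and migration are unrestricted, so a schedule may switch arbitrarily often.
  Measurability is exactly what makes the amount of work done meaningful
  (\<^const>\<open>measure\<close> is 0 on non-measurable sets).
\<close>

definition feasible ::
  "nat \<Rightarrow> real \<Rightarrow> nat \<Rightarrow> (nat \<Rightarrow> real) \<Rightarrow> (nat \<Rightarrow> real) \<Rightarrow> schedule \<Rightarrow> bool" where
  "feasible m s n r p S \<longleftrightarrow>
     (\<forall>k<m. \<forall>i<n. {t. S t k = Some i} \<in> sets lebesgue) \<and>
     (\<forall>t. processed m S t \<subseteq> alive m s n r p S t) \<and>
     (\<forall>t. \<forall>k<m. \<forall>l<m. \<forall>i. S t k = Some i \<and> S t l = Some i \<longrightarrow> k = l)"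

text \<open>The completion time of a job that is never completed is \<open>\<infinity>\<close>.\<close>

definition completion_time ::
  "nat \<Rightarrow> real \<Rightarrow> (nat \<Rightarrow> real) \<Rightarrow> (nat \<Rightarrow> real) \<Rightarrow> schedule \<Rightarrow> nat \<Rightarrow> ereal" where
  "completion_time m s r p S i = Inf {ereal t | t. p i \<le> work_done m s r S i t}"

definition total_flow_time ::
  "nat \<Rightarrow> real \<Rightarrow> nat \<Rightarrow> (nat \<Rightarrow> real) \<Rightarrow> (nat \<Rightarrow> real) \<Rightarrow> schedule \<Rightarrow> ereal" where
  "total_flow_time m s n r p S = (\<Sum>i<n. completion_time m s r p S i - ereal (r i))"

text \<open>The optimum is taken on machines of speed 1.\<close>

definition optimal_flow_time ::
  "nat \<Rightarrow> nat \<Rightarrow> (nat \<Rightarrow> real) \<Rightarrow> (nat \<Rightarrow> real) \<Rightarrow> ereal" where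
  "optimal_flow_time m n r p = (INF S\<in>{S. feasible m 1 n r p S}. total_flow_time m 1 n r p S)"

text \<open>
  Ties are broken arbitrarily, so an instance may admit many SRPT schedules; \<open>srpt\<close>
  characterises all of them.
\<close>

definition srpt ::
  "nat \<Rightarrow> real \<Rightarrow> nat \<Rightarrow> (nat \<Rightarrow> real) \<Rightarrow> (nat \<Rightarrow> real) \<Rightarrow> schedule \<Rightarrow> bool" where
  "srpt m s n r p S \<longleftrightarrow> feasible m s n r p S \<and>
     (\<forall>t. card (processed m S t) = min m (card (alive m s n r p S t)) \<and>
          (\<forall>i \<in> processed m S t. \<forall>j \<in> alive m s n r p S t - processed m S t.
             remaining m s r p S i t \<le> remaining m s r p S j t))"

end

theory Submission imports Defs begin

text \<open>
  Write \<open>s = 1 + \<epsilon>\<close> and compare SRPT with a feasible schedule of speed 1, called the optimum below.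
  While a job \<open>i\<close> waits, all \<open>m\<close> machines work on jobs ahead of it, so its flow time is \<open>p\<^sub>i / s\<close> plus
  \<open>1 / (s m)\<close> times the work done on other jobs meanwhile; a pair of jobs \<open>i, j\<close> contributes to these
  delays at most the smaller of their remaining times at \<open>max r\<^sub>i r\<^sub>j\<close>.

  If \<open>s \<le> 2\<close>, the volume ahead of \<open>i\<close> at its release exceeds the corresponding volume of the optimum by
  at most \<open>m p\<^sub>i\<close>.  The optimum works at rate at most \<open>m\<close>, so \<open>(s - 1) m (C\<^sub>i - r\<^sub>i)\<close> is at most \<open>2 m p\<^sub>i\<close>
  plus what the optimum still has to do, at time \<open>C\<^sub>i\<close>, on the jobs \<open>j\<close> that were ahead of \<open>i\<close>.  This remainder
  is at most the work that SRPT does on \<open>i\<close> while \<open>j\<close> is alive in the optimum, which sums over \<open>i\<close> to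
  at most \<open>s m\<close> times the optimal flow time of \<open>j\<close>.  The ratio is \<open>(2 + s) / (s - 1)\<close>.

  If \<open>s \<ge> 2\<close>, the sum of the truncated remaining times \<open>min \<cdot> x\<close> under SRPT never exceeds that of the
  optimum.  Hence the pairwise delays are bounded by the analogous quantity for the optimum,
  which is at most \<open>m\<close> times its total flow time, and the ratio is \<open>2 / s\<close>.
\<close>

section \<open>Lebesgue measure on the line\<close>


text \<open>The set where \<open>f\<close> is at most 0 is compact, so if it were nonempty it would
  have a least element, which \<open>step\<close> excludes. This serves as induction along
  time.\<close>

lemma positive_persists:
  fixes f :: "real \<Rightarrow> real"
  assumes "continuous_on {a..b} f" "a \<le> b" "0 < f a"
    and step: "\<And>c. a < c \<Longrightarrow> c \<le> b \<Longrightarrow> (\<And>w. a \<le> w \<Longrightarrow> w < c \<Longrightarrow> 0 < f w) \<Longrightarrow> 0 < f c"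
  shows "0 < f b"
proof (rule ccontr)
  assume "\<not> 0 < f b"
  define Z where "Z = {x \<in> {a..b}. f x \<le> 0}"
  have "closed Z"
    unfolding Z_def using assms(1) by (intro continuous_closed_preimage_constant continuous_on_closed_Collect_le) auto
  then have "compact Z"
    unfolding Z_def compact_eq_bounded_closed by (auto intro: bounded_subset[OF bounded_closed_interval])
  moreover have "b \<in> Z" using \<open>\<not> 0 < f b\<close> assms(2) by (auto simp: Z_def)
  ultimately obtain c where c: "c \<in> Z" "\<And>x. x \<in> Z \<Longrightarrow> c \<le> x"
    using compact_attains_inf[of Z] by blast
  from c(1) \<open>0 < f a\<close> have "a < c" "c \<le> b" "f c \<le> 0" by (auto simp: Z_def order.order_iff_strict)
  moreover have "0 < f w" if "a \<le> w" "w < c" for w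
    using c(2)[of w] that \<open>c \<le> b\<close> by (force simp: Z_def)
  ultimately show False using step[of c] by force
qed

text \<open>The cardinality is a sum of indicators. This turns pointwise bounds on the number of
  busy machines into bounds on the total work.\<close>

lemma sum_measure_eq_integral_card:
  fixes A :: "'a::euclidean_space set"
  assumes "finite I" "\<And>i. i \<in> I \<Longrightarrow> Q i \<in> sets lebesgue" "A \<in> lmeasurable"
  shows "(\<Sum>i\<in>I. measure lebesgue (Q i \<inter> A)) = (\<integral>t. real (card {i \<in> I. t \<in> Q i}) * indicat_real A t \<partial>lebesgue)"
    and "integrable lebesgue (\<lambda>t. real (card {i \<in> I. t \<in> Q i}) * indicat_real A t)"
proof -
  have lm: "Q i \<inter> A \<in> lmeasurable" if "i \<in> I" for i
    using fmeasurable_Int_fmeasurable[OF assms(3) assms(2)[OF that]] by (simp add: Int_commute)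
  have eq: "real (card {i \<in> I. t \<in> Q i}) * indicat_real A t = (\<Sum>i\<in>I. indicat_real (Q i \<inter> A) t)" for t
  proof -
    have "real (card {i \<in> I. t \<in> Q i}) = (\<Sum>i\<in>I. indicat_real (Q i) t)"
      using assms(1) sum.inter_filter[of I "\<lambda>_. 1::real" "\<lambda>i. t \<in> Q i"] by (simp add: indicator_def of_bool_def)
    then show ?thesis by (simp add: indicator_inter_arith sum_distrib_right)
  qed
  have int: "integrable lebesgue (indicator (Q i \<inter> A) :: 'a \<Rightarrow> real)" if "i \<in> I" for i
    using lm[OF that] by (simp add: lmeasurable_iff_integrable)
  show "integrable lebesgue (\<lambda>t. real (card {i \<in> I. t \<in> Q i}) * indicat_real A t)"
    unfolding eq using int by auto
  show "(\<Sum>i\<in>I. measure lebesgue (Q i \<inter> A)) = (\<integral>t. real (card {i \<in> I. t \<in> Q i}) * indicat_real A t \<partial>lebesgue)"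
    unfolding eq using int by (subst Bochner_Integration.integral_sum) auto
qed

lemma sum_measure_ge:
  fixes A N :: "'a::euclidean_space set"
  assumes "finite I" "\<And>i. i \<in> I \<Longrightarrow> Q i \<in> sets lebesgue" "A \<in> lmeasurable" "negligible N"
    and card: "\<And>t. t \<in> A \<Longrightarrow> t \<notin> N \<Longrightarrow> c \<le> card {i \<in> I. t \<in> Q i}"
  shows "real c * measure lebesgue A \<le> (\<Sum>i\<in>I. measure lebesgue (Q i \<inter> A))"
proof -
  have int: "integrable lebesgue (indicator A :: 'a \<Rightarrow> real)"
    using assms(3) by (simp add: lmeasurable_iff_integrable)
  have "AE t in lebesgue. t \<notin> N"
    using assms(4) by (simp add: AE_not_in negligible_iff_null_sets)
  then have "AE t in lebesgue. real c * indicator A t \<le> real (card {i \<in> I. t \<in> Q i}) * indicator A t"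
    by eventually_elim (auto simp: indicator_def card)
  then have "(\<integral>t. real c * indicator A t \<partial>lebesgue) \<le> (\<integral>t. real (card {i \<in> I. t \<in> Q i}) * indicat_real A t \<partial>lebesgue)"
    using int sum_measure_eq_integral_card(2)[OF assms(1-3)] by (intro integral_mono_AE) auto
  then show ?thesis
    using sum_measure_eq_integral_card(1)[OF assms(1-3)] int by simp
qed

lemma sum_measure_le:
  fixes A :: "'a::euclidean_space set"
  assumes "finite I" "\<And>i. i \<in> I \<Longrightarrow> Q i \<in> sets lebesgue" "A \<in> lmeasurable"
    and card: "\<And>t. t \<in> A \<Longrightarrow> card {i \<in> I. t \<in> Q i} \<le> c"
  shows "(\<Sum>i\<in>I. measure lebesgue (Q i \<inter> A)) \<le> real c * measure lebesgue A"
proof -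
  have int: "integrable lebesgue (indicator A :: 'a \<Rightarrow> real)"
    using assms(3) by (simp add: lmeasurable_iff_integrable)
  have "(\<integral>t. real (card {i \<in> I. t \<in> Q i}) * indicator A t \<partial>lebesgue) \<le> (\<integral>t. real c * indicat_real A t \<partial>lebesgue)"
  proof (rule integral_mono)
    show "integrable lebesgue (\<lambda>t. real c * indicat_real A t)" using int by simp
    show "integrable lebesgue (\<lambda>t. real (card {i \<in> I. t \<in> Q i}) * indicat_real A t)"
      by (rule sum_measure_eq_integral_card(2)[OF assms(1-3)])
  qed (auto simp: indicator_def card)
  then show ?thesis
    using sum_measure_eq_integral_card(1)[OF assms(1-3)] int by simp
qed

text \<open>Lebesgue measure restricted to \<open>A\<close> and to \<open>B\<close> inside
  \<open>{a<..b}\<close> gives two finite measures that agree on half-lines, hence on all Borel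
  sets. On the Borel part of \<open>A - B\<close> the second one vanishes.\<close>

lemma negligible_Diff_if_same_measure_on_subintervals:
  fixes a b :: real
  assumes "A \<in> sets lebesgue" "B \<in> sets lebesgue"
    and same: "\<And>c. a \<le> c \<Longrightarrow> c \<le> b \<Longrightarrow> measure lebesgue (A \<inter> {c<..b}) = measure lebesgue (B \<inter> {c<..b})"
  shows "negligible ({a<..b} \<inter> (A - B))"
proof -
  \<comment> \<open>The passage to \<open>borel\<close> by \<open>distr\<close> is needed because
    half-lines determine a measure on the Borel sets, whereas \<open>A\<close> and \<open>B\<close>
    are only Lebesgue measurable.\<close>
  define M where "M = (\<lambda>D. distr (density lebesgue (indicator (D \<inter> {a<..b}))) borel (\<lambda>x::real. x))"
  have M: "emeasure (M D) X = emeasure lebesgue (D \<inter> {a<..b} \<inter> X)"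
    if "X \<in> sets borel" "D \<in> sets lebesgue" for D X
  proof -
    have "(\<lambda>x. x) \<in> borel_measurable lebesgue" by (simp add: measurable_completion)
    moreover have "X \<in> sets lebesgue" using that by simp
    ultimately show ?thesis
      using that unfolding M_def
      by (subst emeasure_distr) (auto simp: measurable_def emeasure_restricted intro!: emeasure_restricted)
  qed
  have fin: "D \<inter> {c<..b} \<in> lmeasurable" if "D \<in> sets lebesgue" for D c
    using fmeasurable_Int_fmeasurable[OF _ that, of "{c<..b}"] by (simp add: Int_commute bounded_set_imp_lmeasurable)
  have "M A = M B"
  proof (rule measure_eqI_lessThan)
    show "sets (M A) = sets borel" "sets (M B) = sets borel" by (auto simp: M_def)
    fix x
    have *: "emeasure (M D) {x<..} = ennreal (measure lebesgue (D \<inter> {max a x<..b}))" if "D \<in> sets lebesgue" for D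
    proof -
      have "D \<inter> {a<..b} \<inter> {x<..} = D \<inter> {max a x<..b}" by auto
      then show ?thesis using M[of "{x<..}" D] that fin[OF that, of "max a x"]
        by (simp add: emeasure_eq_measure2)
    qed
    show "emeasure (M A) {x<..} < \<infinity>" using *[OF assms(1)] by simp
    have "measure lebesgue (A \<inter> {max a x<..b}) = measure lebesgue (B \<inter> {max a x<..b})"
      by (cases "max a x \<le> b") (auto intro: same)
    then show "emeasure (M A) {x<..} = emeasure (M B) {x<..}"
      using * assms by simp
  qed
  have "{a<..b} \<inter> (A - B) \<in> sets lebesgue" using assms by (intro sets.Int sets.Diff) auto
  then obtain X Y Z where X: "{a<..b} \<inter> (A - B) = X \<union> Y" "Y \<subseteq> Z" "Z \<in> null_sets lborel" "X \<in> sets lborel"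
    using sets_completionE by blast
  have "emeasure lebesgue X = emeasure lebesgue (A \<inter> {a<..b} \<inter> X)"
    using X(1) by (intro arg_cong[where f="emeasure lebesgue"]) auto
  also have "\<dots> = emeasure (M A) X" using M[of X A] X assms by simp
  also have "\<dots> = emeasure (M B) X" by (simp add: \<open>M A = M B\<close>)
  also have "\<dots> = emeasure lebesgue (B \<inter> {a<..b} \<inter> X)" using M[of X B] X assms by simp
  also have "B \<inter> {a<..b} \<inter> X = {}" using X(1) by auto
  finally have "X \<in> null_sets lebesgue" using X(4) by (auto intro!: null_setsI)
  then have "negligible X" by (simp add: negligible_iff_null_sets)
  moreover have "negligible Y"
    using X by (meson negligible_iff_null_sets negligible_subset null_sets_completionI)
  ultimately show ?thesis using X(1) by (simp add: negligible_Un)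
qed

text \<open>Countably many intervals with rational endpoints in \<open>E\<close> cover the interior
  of \<open>E\<close>, and the frontier of a convex set is negligible.\<close>

lemma negligible_Diff_if_same_measure:
  fixes E :: "real set"
  assumes "A \<in> sets lebesgue" "B \<in> sets lebesgue" "convex E"
    and same: "\<And>a b. a \<in> E \<Longrightarrow> b \<in> E \<Longrightarrow> a \<le> b \<Longrightarrow> measure lebesgue (A \<inter> {a<..b}) = measure lebesgue (B \<inter> {a<..b})"
  shows "negligible (E \<inter> (A - B))"
proof -
  define I where "I = (\<Union>a\<in>\<rat> \<inter> E. \<Union>b\<in>\<rat> \<inter> E. {a<..b} \<inter> (A - B))"
  have E: "c \<in> E" if "a \<in> E" "b \<in> E" "a \<le> c" "c \<le> b" for a b c
    using that \<open>convex E\<close> by (meson is_interval_convex_1 mem_is_interval_1_I)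
  have "negligible I"
    unfolding I_def
  proof (intro negligible_countable_Union countable_image)
    show "countable (\<rat> \<inter> E)" by (simp add: countable_rat)
    fix X assume "X \<in> (\<lambda>a. \<Union>b\<in>\<rat> \<inter> E. {a<..b} \<inter> (A - B)) ` (\<rat> \<inter> E)"
    then obtain a where a: "a \<in> E" "X = (\<Union>b\<in>\<rat> \<inter> E. {a<..b} \<inter> (A - B))" by auto
    have "negligible ({a<..b} \<inter> (A - B))" if "b \<in> E" for b
      using a that assms(1,2) by (intro negligible_Diff_if_same_measure_on_subintervals same) (auto intro: E)
    then show "negligible X" unfolding a(2)
      by (intro negligible_countable_Union countable_image) (auto simp: countable_rat)
  qed
  moreover have "negligible (frontier E)" using assms(3) by (rule negligible_convex_frontier)
  moreover have "E \<inter> (A - B) \<subseteq> I \<union> frontier E"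
  proof
    fix x assume x: "x \<in> E \<inter> (A - B)"
    show "x \<in> I \<union> frontier E"
    proof (cases "x \<in> interior E")
      case True
      then obtain e where e: "e > 0" "ball x e \<subseteq> E" by (meson mem_interior)
      obtain a where a: "a \<in> \<rat>" "x - e < a" "a < x" using Rats_dense_in_real[of "x - e" x] e by auto
      obtain b where b: "b \<in> \<rat>" "x < b" "b < x + e" using Rats_dense_in_real[of x "x + e"] e by auto
      have "a \<in> E" "b \<in> E" using a b e by (auto simp: dist_real_def subset_eq)
      moreover have "x \<in> {a<..b} \<inter> (A - B)" using a b x by auto
      ultimately show ?thesis using a b unfolding I_def by blast
    next
      case False
      then show ?thesis using x by (simp add: frontier_def closure_subset[THEN subsetD])
    qed
  qed
  ultimately show ?thesis by (meson negligible_Un negligible_subset)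
qed

section \<open>Feasible schedules\<close>


locale feasible_schedule =
  fixes m n :: nat and s :: real and r p :: "nat \<Rightarrow> real" and S :: schedule
  assumes m_pos: "1 \<le> m" and s_pos: "0 < s" and inst: "is_instance n r p" and feas: "feasible m s n r p S"
begin

abbreviation proc :: "real \<Rightarrow> nat set" where "proc \<equiv> processed m S"
abbreviation rem :: "nat \<Rightarrow> real \<Rightarrow> real" where "rem \<equiv> remaining m s r p S"
abbreviation live :: "real \<Rightarrow> nat set" where "live \<equiv> alive m s n r p S"

text \<open>The strict inequality matches \<open>{r i<..t}\<close> in \<open>work_done\<close>, so
  that \<open>work\<close> needs no separate mention of the release time.\<close>

definition busy :: "nat \<Rightarrow> real set" where
  "busy i = {t. r i < t \<and> i \<in> proc t}"

definition work :: "nat \<Rightarrow> real \<Rightarrow> real \<Rightarrow> real" where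
  "work i a b = s * measure lebesgue (busy i \<inter> {a<..b})"

lemma p_pos: "i < n \<Longrightarrow> 0 < p i" and r_nonneg: "i < n \<Longrightarrow> 0 \<le> r i"
  using inst by (auto simp: is_instance_def)

lemma live_iff: "i \<in> live t \<longleftrightarrow> i < n \<and> r i \<le> t \<and> 0 < rem i t"
  by (simp add: alive_def)

lemma proc_live: "i \<in> proc t \<Longrightarrow> i \<in> live t"
  using feas by (auto simp: feasible_def)

lemma proc_lt: "i \<in> proc t \<Longrightarrow> i < n"
  by (drule proc_live) (simp add: live_iff)

lemma finite_live [simp]: "finite (live t)"
  by (rule finite_subset[of _ "{..<n}"]) (auto simp: live_iff)

lemma finite_proc [simp]: "finite (proc t)"
  by (rule finite_subset[OF _ finite_live]) (auto intro: proc_live)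

lemma card_proc_le: "card (proc t) \<le> m"
proof -
  have "proc t \<subseteq> (\<lambda>k. the (S t k)) ` {..<m}"
    by (force simp: processed_def)
  then have "card (proc t) \<le> card {..<m}"
    by (meson card_image_le card_mono finite_imageI finite_lessThan le_trans)
  then show ?thesis by simp
qed

lemma busy_sets: "i < n \<Longrightarrow> busy i \<in> sets lebesgue"
proof -
  assume "i < n"
  then have "(\<Union>k<m. {t. S t k = Some i}) \<in> sets lebesgue"
    using feas by (auto simp: feasible_def)
  moreover have "busy i = {r i<..} \<inter> (\<Union>k<m. {t. S t k = Some i})"
    by (auto simp: busy_def processed_def)
  moreover have "{r i<..} \<in> sets lebesgue" by simp
  ultimately show ?thesis by (metis sets.Int)
qed

lemma busy_Int_lmeasurable: "i < n \<Longrightarrow> busy i \<inter> {a<..b} \<in> lmeasurable"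
  using fmeasurable_Int_fmeasurable[OF _ busy_sets, of "{a<..b}" i]
  by (simp add: Int_commute bounded_set_imp_lmeasurable)

lemma rem_eq: "rem i t = p i - s * measure lebesgue (busy i \<inter> {..t})"
  unfolding remaining_def work_done_def
  by (rule arg_cong[where f = "\<lambda>X. p i - s * measure lebesgue X"]) (auto simp: busy_def)

lemma rem_before: "t \<le> r i \<Longrightarrow> rem i t = p i"
  unfolding rem_eq by (subst Int_emptyI) (auto simp: busy_def)

lemma rem_release [simp]: "rem i (r i) = p i"
  by (rule rem_before) simp

lemma rem_diff:
  assumes "i < n" "a \<le> b"
  shows "rem i a - rem i b = work i a b"
proof -
  have bnd: "busy i \<inter> {..t} = busy i \<inter> {r i<..t}" for t by (auto simp: busy_def)
  have lm: "busy i \<inter> {..t} \<in> lmeasurable" for t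
    unfolding bnd by (rule busy_Int_lmeasurable[OF assms(1)])
  have "busy i \<inter> {a<..b} - busy i \<inter> {..a} = busy i \<inter> {a<..b}" by auto
  then have "measure lebesgue ((busy i \<inter> {..a}) \<union> (busy i \<inter> {a<..b})) =
      measure lebesgue (busy i \<inter> {..a}) + measure lebesgue (busy i \<inter> {a<..b})"
    using measure_Un2[OF lm busy_Int_lmeasurable[OF assms(1)], of a a b] by simp
  moreover have "(busy i \<inter> {..a}) \<union> (busy i \<inter> {a<..b}) = busy i \<inter> {..b}" using assms by auto
  ultimately show ?thesis by (simp add: rem_eq work_def algebra_simps)
qed

lemma work_nonneg [simp]: "0 \<le> work i a b"
  using s_pos by (simp add: work_def)

lemma work_mono:
  assumes "i < n" "c \<le> a" "b \<le> d"
  shows "work i a b \<le> work i c d"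
proof -
  have "measure lebesgue (busy i \<inter> {a<..b}) \<le> measure lebesgue (busy i \<inter> {c<..d})"
  proof (rule measure_mono_fmeasurable)
    show "busy i \<inter> {a<..b} \<in> sets lebesgue" by (rule fmeasurableD[OF busy_Int_lmeasurable[OF assms(1)]])
  qed (use assms busy_Int_lmeasurable in auto)
  then show ?thesis using s_pos by (simp add: work_def)
qed

lemma work_le_time:
  assumes "i < n" "a \<le> b"
  shows "work i a b \<le> s * (b - a)"
proof -
  have "measure lebesgue (busy i \<inter> {a<..b}) \<le> measure lebesgue {a<..b}"
  proof (rule measure_mono_fmeasurable)
    show "busy i \<inter> {a<..b} \<in> sets lebesgue" by (rule fmeasurableD[OF busy_Int_lmeasurable[OF assms(1)]])
  qed (simp_all add: bounded_set_imp_lmeasurable)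
  then show ?thesis using assms s_pos by (simp add: work_def)
qed

lemma rem_antimono: "i < n \<Longrightarrow> a \<le> b \<Longrightarrow> rem i b \<le> rem i a"
  using rem_diff[of i a b] work_nonneg[of i a b] by linarith

lemma rem_le_p: "i < n \<Longrightarrow> rem i t \<le> p i"
  using s_pos by (simp add: rem_eq)

text \<open>A job is processed at rate at most \<open>s\<close>, so its remaining time is
  Lipschitz.\<close>

lemma continuous_rem:
  assumes "i < n"
  shows "continuous_on X (rem i)"
proof -
  have "dist (rem i x) (rem i y) \<le> s * dist x y" for x y
    using rem_diff[OF assms, of x y] rem_diff[OF assms, of y x] work_le_time[OF assms, of x y]
      work_le_time[OF assms, of y x] work_nonneg[of i x y] work_nonneg[of i y x]
    by (cases "x \<le> y") (simp_all add: dist_real_def abs_le_iff del: work_nonneg)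
  then have "s-lipschitz_on UNIV (rem i)" using s_pos by (intro lipschitz_onI) auto
  then show ?thesis using lipschitz_on_continuous_on continuous_on_subset by blast
qed

lemma work_eq_0:
  assumes "\<And>t. a < t \<Longrightarrow> t < b \<Longrightarrow> t \<notin> N \<Longrightarrow> t \<notin> busy i" "negligible N"
  shows "work i a b = 0"
proof -
  have "busy i \<inter> {a<..b} \<subseteq> insert b N" using assms by force
  then have "negligible (busy i \<inter> {a<..b})"
    using assms(2) by (meson negligible_insert negligible_subset)
  then show ?thesis by (simp add: work_def negligible_imp_measure0)
qed

text \<open>A feasible schedule runs a job only while its remaining time is positive. After the last
  time \<open>c\<close> at which that time is nonnegative the job is never run, so it cannot drop
  below 0.\<close>

lemma rem_nonneg: "i < n \<Longrightarrow> 0 \<le> rem i t"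
proof (rule ccontr)
  assume i: "i < n" and "\<not> 0 \<le> rem i t"
  define Z where "Z = {x \<in> {r i..t}. 0 \<le> rem i x}"
  have t: "r i \<le> t"
    using \<open>\<not> 0 \<le> rem i t\<close> rem_before[of t i] p_pos[OF i] by linarith
  have "closed Z" unfolding Z_def
    using continuous_rem[OF i] by (intro continuous_on_closed_Collect_le) auto
  then have "compact Z"
    unfolding Z_def compact_eq_bounded_closed by (auto intro: bounded_subset[OF bounded_closed_interval])
  moreover have "r i \<in> Z" using t p_pos[OF i] by (simp add: Z_def)
  ultimately obtain c where c: "c \<in> Z" "\<And>x. x \<in> Z \<Longrightarrow> x \<le> c"
    using compact_attains_sup[of Z] by blast
  have "work i c t = 0"
  proof (rule work_eq_0)
    fix x assume "c < x" "x < t"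
    then have "x \<notin> Z" using c(2)[of x] by linarith
    then have "rem i x < 0" using \<open>c < x\<close> \<open>x < t\<close> c(1) by (auto simp: Z_def)
    then show "x \<notin> busy i" by (auto simp: busy_def dest!: proc_live simp: live_iff)
  qed (rule negligible_empty)
  then show False using rem_diff[OF i, of c t] c(1) \<open>\<not> 0 \<le> rem i t\<close> by (auto simp: Z_def)
qed

lemma work_le_rem: "i < n \<Longrightarrow> a \<le> b \<Longrightarrow> work i a b \<le> rem i a"
  using rem_diff[of i a b] rem_nonneg[of i b] by linarith

lemma card_busy_le: "card {i \<in> I. t \<in> busy i} \<le> m"
proof -
  have "{i \<in> I. t \<in> busy i} \<subseteq> proc t" by (auto simp: busy_def)
  from card_mono[OF finite_proc this] show ?thesis using card_proc_le le_trans by blast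
qed

lemma sum_work_le:
  assumes "I \<subseteq> {..<n}" "a \<le> b"
  shows "(\<Sum>i\<in>I. work i a b) \<le> s * real m * (b - a)"
proof -
  have "(\<Sum>i\<in>I. measure lebesgue (busy i \<inter> {a<..b})) \<le> real m * measure lebesgue {a<..b}"
    using assms by (intro sum_measure_le card_busy_le busy_sets)
      (auto intro: finite_subset bounded_set_imp_lmeasurable)
  then show ?thesis
    using s_pos assms by (simp add: work_def flip: sum_distrib_left)
qed

lemma sum_work_ge:
  assumes "I \<subseteq> {..<n}" "a \<le> b" "negligible N"
    and "\<And>t. a < t \<Longrightarrow> t < b \<Longrightarrow> t \<notin> N \<Longrightarrow> c \<le> card {i \<in> I. t \<in> busy i}"
  shows "s * real c * (b - a) \<le> (\<Sum>i\<in>I. work i a b)"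
proof -
  have "real c * measure lebesgue {a<..b} \<le> (\<Sum>i\<in>I. measure lebesgue (busy i \<inter> {a<..b}))"
    \<comment> \<open>The endpoint \<open>b\<close> joins the null set because the hypothesis speaks
      of the open interval only.\<close>
    using assms by (intro sum_measure_ge[where N = "insert b N"] busy_sets)
      (auto intro: finite_subset bounded_set_imp_lmeasurable)
  then show ?thesis
    using s_pos assms by (simp add: work_def flip: sum_distrib_left)
qed

section \<open>Completion times as real numbers\<close>

definition completes :: "nat \<Rightarrow> real \<Rightarrow> bool" where
  "completes i C \<longleftrightarrow> r i < C \<and> rem i C = 0 \<and> (\<forall>t<C. 0 < rem i t)"

text \<open>\<open>C\<close> is the first zero of the remaining time, which exists by compactness.
  Monotonicity makes the set in \<open>completion_time\<close> the half-line starting at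
  \<open>C\<close>.\<close>

lemma completesI:
  assumes i: "i < n" and T: "rem i T = 0"
  obtains C where "completes i C" "completion_time m s r p S i = ereal C"
proof -
  define Z where "Z = {x \<in> {r i..T}. rem i x \<le> 0}"
  have "r i \<le> T" using T rem_before[of T i] p_pos[OF i] by force
  have "closed Z" unfolding Z_def
    using continuous_rem[OF i] by (intro continuous_on_closed_Collect_le) auto
  then have "compact Z"
    unfolding Z_def compact_eq_bounded_closed by (auto intro: bounded_subset[OF bounded_closed_interval])
  moreover have "T \<in> Z" using \<open>r i \<le> T\<close> T by (simp add: Z_def)
  ultimately obtain C where C: "C \<in> Z" "\<And>x. x \<in> Z \<Longrightarrow> C \<le> x"
    using compact_attains_inf[of Z] by blast
  have pos: "0 < rem i t" if "t < C" for t
  proof (cases "t \<le> r i")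
    case True then show ?thesis using p_pos[OF i] by (simp add: rem_before)
  next
    case False then show ?thesis using C(2)[of t] C(1) that by (force simp: Z_def)
  qed
  have C0: "rem i C = 0" using C(1) rem_nonneg[OF i, of C] by (auto simp: Z_def)
  have "r i \<noteq> C" using C0 p_pos[OF i] by (metis less_irrefl rem_release)
  then have "completes i C" using C0 pos C(1) by (auto simp: completes_def Z_def)
  moreover have "completion_time m s r p S i = ereal C"
  proof -
    have "p i \<le> work_done m s r S i t \<longleftrightarrow> C \<le> t" for t
      using pos[of t] rem_antimono[OF i, of C t] C0 by (auto simp: remaining_def not_less[symmetric])
    then show ?thesis unfolding completion_time_def
      by (intro antisym Inf_lower Inf_greatest) auto
  qed
  ultimately show thesis by (rule that)
qed

lemma completion_time_finite:
  assumes i: "i < n" and "completion_time m s r p S i \<noteq> \<infinity>"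
  obtains C where "completes i C" "completion_time m s r p S i = ereal C"
proof -
  have "{ereal t | t. p i \<le> work_done m s r S i t} \<noteq> {}"
    using assms(2) unfolding completion_time_def by (metis Inf_empty top_ereal_def)
  then obtain T where "p i \<le> work_done m s r S i T" by auto
  then have "rem i T = 0" using rem_nonneg[OF i, of T] by (simp add: remaining_def)
  from completesI[OF i this] that show thesis by blast
qed

lemma live_iff_lt: "i < n \<Longrightarrow> completes i C \<Longrightarrow> i \<in> live t \<longleftrightarrow> r i \<le> t \<and> t < C"
  using rem_antimono[of i C t] by (auto simp: live_iff completes_def not_less[symmetric])

lemma rem_after: "i < n \<Longrightarrow> completes i C \<Longrightarrow> C \<le> t \<Longrightarrow> rem i t = 0"
  using rem_antimono[of i C t] rem_nonneg[of i t] by (simp add: completes_def)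

lemma work_until_completion: "i < n \<Longrightarrow> completes i C \<Longrightarrow> a \<le> b \<Longrightarrow> C \<le> b \<Longrightarrow> work i a b = rem i a"
  using rem_diff[of i a b] rem_after[of i C b] by simp

lemma p_le_flow: "i < n \<Longrightarrow> completes i C \<Longrightarrow> p i \<le> s * (C - r i)"
  using work_until_completion[of i C "r i" C] work_le_time[of i "r i" C] by (simp add: completes_def)

end

section \<open>SRPT schedules\<close>


locale srpt_schedule = feasible_schedule +
  assumes srpt: "srpt m s n r p S"
begin

lemma card_proc: "card (proc t) = min m (card (live t))"
  using srpt by (simp add: srpt_def)

lemma proc_rem_le: "i \<in> proc t \<Longrightarrow> j \<in> live t \<Longrightarrow> j \<notin> proc t \<Longrightarrow> rem i t \<le> rem j t"
  using srpt by (auto simp: srpt_def)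

lemma card_proc_if_waiting:
  assumes "j \<in> live t" "j \<notin> proc t"
  shows "card (proc t) = m"
proof -
  have "proc t \<subset> live t" using assms proc_live by blast
  then have "card (proc t) < card (live t)" by (simp add: psubset_card_mono)
  then show ?thesis by (simp add: card_proc min_def split: if_splits)
qed

text \<open>As long as \<open>i\<close> is alive and strictly smaller, SRPT never runs
  \<open>j\<close> without \<open>i\<close>, so \<open>j\<close> cannot catch up. Positivity at
  \<open>w\<close> keeps \<open>i\<close> alive throughout; afterwards both remaining times may be
  0.\<close>

lemma rem_less_persists:
  assumes "i < n" "j < n" "r i \<le> u" "r j \<le> u" "rem i u < rem j u" "u \<le> w" "0 < rem i w"
  shows "rem i w < rem j w"
proof -
  have "0 < rem j w - rem i w"
  proof (rule positive_persists[where f = "\<lambda>t. rem j t - rem i t" and a = u and b = w])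
    fix c assume c: "u < c" "c \<le> w" "\<And>x. u \<le> x \<Longrightarrow> x < c \<Longrightarrow> 0 < rem j x - rem i x"
    have "x \<in> busy i" if x: "u < x" "x < c" "x \<in> busy j" for x
    proof (rule ccontr)
      assume "x \<notin> busy i"
      moreover have "i \<in> live x"
        using assms x c(2) rem_antimono[of i x w] by (simp add: live_iff)
      ultimately show False
        using proc_rem_le[of j x i] c(3)[of x] x assms by (auto simp: busy_def)
    qed
    then have "busy j \<inter> {u<..c} \<subseteq> busy i \<inter> {u<..c} \<union> {c}" by force
    then have "measure lebesgue (busy j \<inter> {u<..c}) \<le> measure lebesgue (busy i \<inter> {u<..c} \<union> {c})"
    proof (rule measure_mono_fmeasurable)
      show "busy i \<inter> {u<..c} \<union> {c} \<in> lmeasurable"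
        using busy_Int_lmeasurable[OF assms(1)] by (rule fmeasurable.Un) (simp add: negligible_imp_measurable)
    qed (use busy_Int_lmeasurable[OF assms(2)] in \<open>rule fmeasurableD\<close>)
    also have "\<dots> = measure lebesgue (busy i \<inter> {u<..c})"
      using busy_Int_lmeasurable assms
      by (intro measure_Un_null_set) (auto intro: fmeasurableD simp: negligible_iff_null_sets[symmetric])
    finally have "work j u c \<le> work i u c" using s_pos by (simp add: work_def)
    then show "0 < rem j c - rem i c"
      using rem_diff[of i u c] rem_diff[of j u c] assms c(1) by simp
  qed (use assms continuous_rem in \<open>auto intro: continuous_on_diff\<close>)
  then show ?thesis by simp
qed

text \<open>
  By \<open>rem_less_persists\<close>, the order of two released jobs by remaining time never changes, up to ties,
  so it may be required for the whole future.  This makes it robust against the arbitrary tie breaking.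
\<close>

definition ahead :: "real \<Rightarrow> nat \<Rightarrow> nat \<Rightarrow> bool" where
  "ahead u i j \<longleftrightarrow> (\<forall>w\<ge>u. rem i w \<le> rem j w)"

lemma ahead_refl [simp]: "ahead u i i"
  by (simp add: ahead_def)

lemma ahead_trans: "ahead u i j \<Longrightarrow> ahead u j k \<Longrightarrow> ahead u i k"
  unfolding ahead_def by (meson order.trans)

lemma ahead_later: "ahead u i j \<Longrightarrow> u \<le> v \<Longrightarrow> ahead v i j"
  by (auto simp: ahead_def)

lemma aheadD: "ahead u i j \<Longrightarrow> u \<le> w \<Longrightarrow> rem i w \<le> rem j w"
  by (simp add: ahead_def)

text \<open>Otherwise the strict order takes both directions at two times \<open>a\<close> and
  \<open>b\<close>. The order at the earlier one persists until the later one, unless the smaller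
  job is finished by then, and in that case the other one would have negative remaining
  time.\<close>

lemma ahead_total:
  assumes "i < n" "j < n" "r i \<le> u" "r j \<le> u"
  shows "ahead u i j \<or> ahead u j i"
proof (rule ccontr)
  assume "\<not> ?thesis"
  then obtain a b where ab: "u \<le> a" "rem j a < rem i a" "u \<le> b" "rem i b < rem j b"
    by (auto simp: ahead_def not_le)
  show False
  proof (cases "a \<le> b")
    case True
    then show False
      using rem_less_persists[of j i a b] rem_nonneg[of j b] rem_nonneg[of i b] ab assms by (cases "rem j b = 0") auto
  next
    case False
    then show False
      using rem_less_persists[of i j b a] rem_nonneg[of j a] rem_nonneg[of i a] ab assms by (cases "rem i a = 0") auto
  qed
qed

lemma ahead_if_rem_less:
  assumes "i < n" "j < n" "r i \<le> u" "r j \<le> u" "rem i u < rem j u"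
  shows "ahead u i j"
  using ahead_total[OF assms(1-4)] aheadD[of u j i u] assms(5) by force

lemma ex_first:
  assumes "finite X" "X \<noteq> {}" "\<And>i. i \<in> X \<Longrightarrow> i < n \<and> r i \<le> u"
  shows "\<exists>i\<in>X. \<forall>j\<in>X. ahead u i j"
  using assms
proof (induction rule: finite_ne_induct)
  case (insert a X)
  then obtain i where i: "i \<in> X" "\<forall>j\<in>X. ahead u i j" by blast
  have "ahead u i a \<or> ahead u a i" using insert.prems i(1) by (intro ahead_total) auto
  then show ?case using i ahead_trans by (metis ahead_refl insert_iff)
qed simp

lemma ex_last:
  assumes "finite X" "X \<noteq> {}" "\<And>i. i \<in> X \<Longrightarrow> i < n \<and> r i \<le> u"
  shows "\<exists>i\<in>X. \<forall>j\<in>X. ahead u j i"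
  using assms
proof (induction rule: finite_ne_induct)
  case (insert a X)
  then obtain i where i: "i \<in> X" "\<forall>j\<in>X. ahead u j i" by blast
  have "ahead u i a \<or> ahead u a i" using insert.prems i(1) by (intro ahead_total) auto
  then show ?case using i ahead_trans by (metis ahead_refl insert_iff)
qed simp

text \<open>The times at which tie breaking alone decides between some processed job and some
  waiting one.\<close>

definition ties :: "real set" where
  "ties = {t. \<exists>i\<in>proc t. \<exists>j\<in>live t - proc t. rem i t = rem j t}"

text \<open>
  Two jobs are tied during an interval of time, and on each of its subintervals they receive the
  same amount of processing; so almost always both or none of them are processed.
\<close>

lemma negligible_ties: "negligible ties"
proof -
  define T where "T i j = {t. i \<in> proc t \<and> j \<in> live t - proc t \<and> rem i t = rem j t}" for i j
  have "negligible (T i j)" if ij: "i < n" "j < n" for i j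
  proof -
    \<comment> \<open>\<open>E\<close> is convex: a strict order between two times of
      \<open>E\<close> would persist until the later one, where the jobs are tied and alive.\<close>
    define E where "E = {t. r i \<le> t \<and> r j \<le> t \<and> rem i t = rem j t \<and> 0 < rem i t}"
    have "x \<in> E" if "a \<in> E" "b \<in> E" "a \<le> x" "x \<le> b" for a b x
      using that rem_less_persists[of i j x b] rem_less_persists[of j i x b] rem_antimono[of i x b] ij
      by (fastforce simp: E_def)
    then have "convex E"
      unfolding is_interval_convex_1[symmetric] is_interval_1 by blast
    moreover have "measure lebesgue (busy i \<inter> {a<..b}) = measure lebesgue (busy j \<inter> {a<..b})"
      if "a \<in> E" "b \<in> E" "a \<le> b" for a b
      using that rem_diff[of i a b] rem_diff[of j a b] ij s_pos by (auto simp: E_def work_def)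
    ultimately have "negligible (E \<inter> (busy i - busy j))"
      using ij by (intro negligible_Diff_if_same_measure busy_sets)
    \<comment> \<open>At the instant \<open>r i\<close> the job may be processed without counting as
      busy.\<close>
    moreover have "T i j \<subseteq> insert (r i) (E \<inter> (busy i - busy j))"
      by (auto simp: T_def E_def busy_def live_iff dest: proc_live)
    ultimately show ?thesis by (meson negligible_insert negligible_subset)
  qed
  then have "negligible (\<Union>i<n. \<Union>j<n. T i j)" by (intro negligible_Union) auto
  moreover have "ties \<subseteq> (\<Union>i<n. \<Union>j<n. T i j)"
    using proc_lt by (fastforce simp: ties_def T_def live_iff)
  ultimately show ?thesis by (rule negligible_subset)
qed

lemma proc_rem_less: "t \<notin> ties \<Longrightarrow> i \<in> proc t \<Longrightarrow> j \<in> live t \<Longrightarrow> j \<notin> proc t \<Longrightarrow> rem i t < rem j t"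
  using proc_rem_le[of i t j] by (auto simp: ties_def less_le)

lemma proc_eq_busy: "t \<notin> r ` {..<n} \<Longrightarrow> j \<in> proc t \<longleftrightarrow> t \<in> busy j"
  using proc_live[of j t] by (force simp: busy_def live_iff)

text \<open>After the last release some machine works whenever a job is alive, so the total volume
  is exhausted within time \<open>(\<Sum>i<n. p i) / s\<close>.\<close>

lemma ex_all_complete: "\<exists>T. \<forall>i<n. rem i T = 0"
proof -
  define R where "R = (\<Sum>i<n. r i)"
  \<comment> \<open>The extra 1 makes the available work exceed the total volume strictly.\<close>
  define T where "T = R + ((\<Sum>i<n. p i) / s + 1)"
  have rR: "r i \<le> R" if "i < n" for i
    unfolding R_def using that r_nonneg by (intro member_le_sum) auto
  have "0 \<le> (\<Sum>i<n. p i)" using p_pos by (intro sum_nonneg) (auto intro: less_imp_le)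
  then have "R \<le> T" using s_pos by (simp add: T_def)
  have "rem i T = 0" if i: "i < n" for i
  proof (rule ccontr)
    assume "rem i T \<noteq> 0"
    then have "0 < rem i T" using rem_nonneg[OF i, of T] by simp
    have "1 \<le> card {j \<in> {..<n}. t \<in> busy j}" if t: "R < t" "t < T" for t
    proof -
      have "i \<in> live t" using rR[OF i] t i rem_antimono[OF i, of t T] \<open>0 < rem i T\<close> by (simp add: live_iff)
      then have "0 < card (proc t)" using m_pos by (auto simp: card_proc card_gt_0_iff)
      moreover have "proc t \<subseteq> {j \<in> {..<n}. t \<in> busy j}"
        using rR t by (force simp: busy_def dest: proc_lt)
      then have "card (proc t) \<le> card {j \<in> {..<n}. t \<in> busy j}" by (intro card_mono) auto
      ultimately show ?thesis by simp
    qed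
    then have "s * real 1 * (T - R) \<le> (\<Sum>j<n. work j R T)"
      using \<open>R \<le> T\<close> by (intro sum_work_ge[where N = "{}"]) auto
    also have "\<dots> \<le> (\<Sum>j<n. p j)"
      using work_le_rem[of _ R T] rem_le_p[of _ R] \<open>R \<le> T\<close> by (intro sum_mono) (force intro: order.trans)
    also have "s * real 1 * (T - R) = (\<Sum>j<n. p j) + s" using s_pos by (simp add: T_def distrib_left)
    finally show False using s_pos by simp
  qed
  then show ?thesis by blast
qed

lemma ex_completes: "i < n \<Longrightarrow> \<exists>C. completes i C \<and> completion_time m s r p S i = ereal C"
  using ex_all_complete completesI by metis

text \<open>The work done on \<open>j\<close> while \<open>i\<close> waits; \<open>C\<close> stands for the completion time of \<open>i\<close>.\<close>

definition delay :: "nat \<Rightarrow> real \<Rightarrow> nat \<Rightarrow> real" where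
  "delay i C j = s * measure lebesgue ((busy j - busy i) \<inter> {r i<..C})"

text \<open>The waiting time of \<open>i\<close> is \<open>C - r i - p i / s\<close>, and while
  \<open>i\<close> waits all \<open>m\<close> machines run other jobs.\<close>

lemma flow_le_delay:
  assumes i: "i < n" and C: "completes i C"
  shows "s * real m * (C - r i) \<le> real m * p i + (\<Sum>j\<in>{..<n} - {i}. delay i C j)"
proof -
  define A where "A = {r i<..C} - busy i"
  have lm: "{r i<..C} \<in> lmeasurable" by (simp add: bounded_set_imp_lmeasurable)
  have A: "A \<in> lmeasurable" unfolding A_def by (rule fmeasurable_Diff[OF lm busy_sets[OF i]])
  have "real m * measure lebesgue A \<le> (\<Sum>j\<in>{..<n} - {i}. measure lebesgue (busy j \<inter> A))"
  proof (rule sum_measure_ge[OF _ _ A])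
    show "negligible (insert C (r ` {..<n}))" by (simp add: negligible_finite)
    fix t assume t: "t \<in> A" "t \<notin> insert C (r ` {..<n})"
    have "i \<in> live t" "i \<notin> proc t"
      using t live_iff_lt[OF i C, of t] by (auto simp: A_def busy_def)
    then have "card (proc t) = m" by (rule card_proc_if_waiting)
    moreover have "proc t = {j \<in> {..<n} - {i}. t \<in> busy j}"
      using t proc_eq_busy[of t] \<open>i \<notin> proc t\<close> by (auto dest: proc_lt)
    ultimately show "m \<le> card {j \<in> {..<n} - {i}. t \<in> busy j}" by simp
  qed (auto intro: busy_sets)
  also have "\<dots> = (\<Sum>j\<in>{..<n} - {i}. delay i C j) / s"
    using s_pos by (auto simp: delay_def A_def sum_divide_distrib intro!: sum.cong arg_cong[where f = "measure lebesgue"])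
  finally have "s * (real m * measure lebesgue A) \<le> (\<Sum>j\<in>{..<n} - {i}. delay i C j)"
    using s_pos by (simp add: field_simps)
  moreover have "measure lebesgue A = (C - r i) - p i / s"
  proof -
    have "measure lebesgue {r i<..C} = measure lebesgue (busy i \<inter> {r i<..C}) + measure lebesgue A"
      using measure_Un2[OF busy_Int_lmeasurable[OF i, of "r i" C] lm] A
      by (simp add: A_def Int_absorb1 Un_absorb1 Diff_Int)
    moreover have "p i = s * measure lebesgue (busy i \<inter> {r i<..C})"
      using work_until_completion[OF i C, of "r i" C] C by (simp add: work_def completes_def)
    ultimately show ?thesis using s_pos C by (simp add: completes_def)
  qed
  moreover have "s * (real m * ((C - r i) - p i / s)) = s * real m * (C - r i) - real m * p i"
    using s_pos by (simp add: field_simps)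
  ultimately show ?thesis by simp
qed

lemma delay_le_rem:
  assumes "i < n" "j < n"
  shows "delay i C j \<le> rem j (max (r i) (r j))"
proof (cases "max (r i) (r j) \<le> C")
  case True
  have "(busy j - busy i) \<inter> {r i<..C} = busy j \<inter> {max (r i) (r j)<..C} - busy i"
    by (auto simp: busy_def)
  then have "delay i C j \<le> work j (max (r i) (r j)) C"
    unfolding delay_def work_def
    using s_pos fmeasurable_Diff[OF busy_Int_lmeasurable[OF assms(2)] busy_sets[OF assms(1)]] busy_Int_lmeasurable[OF assms(2)]
    by (auto intro!: mult_left_mono measure_mono_fmeasurable dest: fmeasurableD)
  also have "\<dots> \<le> rem j (max (r i) (r j))" using True assms by (intro work_le_rem)
  finally show ?thesis .
next
  case False
  then have "(busy j - busy i) \<inter> {r i<..C} = {}" by (auto simp: busy_def)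
  then show ?thesis using rem_nonneg[OF assms(2)] by (simp add: delay_def)
qed

text \<open>SRPT runs \<open>j\<close> while the smaller job \<open>i\<close> waits only at a tie,
  and the ties are negligible.\<close>

lemma delay_eq_0_if_ahead:
  assumes "i < n" "j < n" "completes i C" "ahead (max (r i) (r j)) i j"
  shows "delay i C j = 0"
proof -
  have "(busy j - busy i) \<inter> {r i<..C} \<subseteq> insert C ties"
  proof
    fix t assume t: "t \<in> (busy j - busy i) \<inter> {r i<..C}"
    show "t \<in> insert C ties"
    proof (rule ccontr)
      assume "t \<notin> insert C ties"
      moreover from this have "i \<in> live t" using t live_iff_lt[OF assms(1,3), of t] by auto
      ultimately have "rem j t < rem i t"
        using t by (intro proc_rem_less) (auto simp: busy_def)
      moreover have "rem i t \<le> rem j t" using t by (intro aheadD[OF assms(4)]) (auto simp: busy_def)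
      ultimately show False by simp
    qed
  qed
  then have "negligible ((busy j - busy i) \<inter> {r i<..C})"
    using negligible_ties by (meson negligible_insert negligible_subset)
  then show ?thesis by (simp add: delay_def negligible_imp_measure0)
qed

lemma delay_eq_0_if_late: "C \<le> r j \<Longrightarrow> delay i C j = 0"
  unfolding delay_def by (subst Int_emptyI) (auto simp: busy_def)

lemma delay_le:
  assumes "i < n" "j < n" "completes i C" and \<tau>: "\<tau> = max (r i) (r j)"
  shows "delay i C j \<le> (if rem j \<tau> \<le> rem i \<tau> then rem j \<tau> else 0)"
  using delay_le_rem[of i j C] delay_eq_0_if_ahead[of i j C] ahead_if_rem_less[of i j \<tau>] assms by auto

text \<open>One of the two jobs is ahead of the other and is not delayed by it; the delay of the
  other is at most the remaining time of the one ahead, which is the minimum.\<close>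

lemma delay_add_le:
  assumes "i < n" "j < n" "completes i C" "completes j D" and \<tau>: "\<tau> = max (r i) (r j)"
  shows "delay i C j + delay j D i \<le> min (rem i \<tau>) (rem j \<tau>)"
proof -
  have \<tau>': "max (r j) (r i) = \<tau>" using \<tau> by auto
  have "ahead \<tau> i j \<or> ahead \<tau> j i" using assms by (intro ahead_total) auto
  then show ?thesis
  proof
    assume *: "ahead \<tau> i j"
    then show ?thesis
      using delay_eq_0_if_ahead[of i j C] delay_le_rem[of j i D] aheadD[OF *, of \<tau>] assms \<tau>' by auto
  next
    assume *: "ahead \<tau> j i"
    then show ?thesis
      using delay_eq_0_if_ahead[of j i D] delay_le_rem[of i j C] aheadD[OF *, of \<tau>] assms \<tau>' by auto
  qed
qed

end

section \<open>Volume of the small jobs\<close>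


text \<open>\<open>Q\<close> is an arbitrary feasible schedule of speed 1; optimality is not
  assumed, so the bounds hold against every competitor.\<close>

locale srpt_and_optimum =
  alg: srpt_schedule m n s r p S + opt: feasible_schedule m n 1 r p Q
  for m n :: nat and s :: real and r p :: "nat \<Rightarrow> real" and S Q :: schedule
begin

text \<open>
  Let \<open>t'\<close> be the last time at which at most \<open>m\<close> live jobs had remaining time at most \<open>y\<close>.  From then on, SRPT
  only works on such jobs, at full rate \<open>s m\<close>, and they are the at most \<open>m\<close> old ones in \<open>G\<close> and the
  newly released ones in \<open>New\<close>.
\<close>

lemma small_volume_le:
  assumes J: "J \<subseteq> {..<n}" "\<And>j. j \<in> J \<Longrightarrow> r j \<le> t" "\<And>j. j < n \<Longrightarrow> r j < t \<Longrightarrow> j \<in> J"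
    and "0 < y" "1 \<le> s"
  shows "(\<Sum>j | j \<in> J \<and> alg.rem j t \<le> y. alg.rem j t)
      \<le> (\<Sum>j | j \<in> J \<and> opt.rem j t \<le> y. opt.rem j t) + real m * y"
proof -
  define small where "small w = {j \<in> alg.live w. alg.rem j w \<le> y}" for w
  \<comment> \<open>\<open>U\<close> is nonempty because nothing is live before time 0. Its supremum
    need not belong to it, so \<open>cardG\<close> takes an argument of its own.\<close>
  define U where "U = {w. w < t \<and> card (small w) \<le> m}"
  define t' where "t' = Sup U"
  define G where "G = {j. j < n \<and> r j < t' \<and> 0 < alg.rem j t' \<and> alg.rem j t' \<le> y}"
  \<comment> \<open>The set \<open>J\<close> only decides which of the jobs released exactly at
    \<open>t\<close> are counted.\<close>
  define New where "New = {j \<in> J. t' \<le> r j \<and> p j \<le> y}"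
  have fin: "finite J" "finite G" "finite New"
    using J(1) by (auto simp: G_def New_def intro: finite_subset)
  have sub: "G \<union> New \<subseteq> {..<n}" using J(1) by (auto simp: G_def New_def)
  have bdd: "bdd_above U" by (auto simp: U_def bdd_above_def intro: less_imp_le)
  have "small (min t 0 - 1) = {}"
  proof -
    have "\<not> r j \<le> min t 0 - 1" if "j < n" for j using alg.r_nonneg[OF that] by linarith
    then show ?thesis by (auto simp: small_def alg.live_iff)
  qed
  then have "min t 0 - 1 \<in> U" by (simp add: U_def)
  then have "U \<noteq> {}" by blast
  then have t': "t' \<le> t" unfolding t'_def by (intro cSup_least) (auto simp: U_def)

  \<comment> \<open>If \<open>G\<close> had more than \<open>m\<close> jobs, take \<open>w\<close>
    in \<open>U\<close> after all their releases. Some job of \<open>G\<close> exceeds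
    \<open>y\<close> at \<open>w\<close>, hence so does the last one. That one is never run up to
    \<open>t'\<close>, since the machines cannot hold all of \<open>G\<close>; so it still exceeds
    \<open>y\<close> at \<open>t'\<close>.\<close>
  have cardG: "card G \<le> m"
  proof (rule ccontr)
    assume "\<not> card G \<le> m"
    then have "G \<noteq> {}" by auto
    then have "Max (r ` G) < t'" using fin by (simp add: G_def)
    then obtain w where w: "w \<in> U" "Max (r ` G) < w"
      using less_cSupD[OF \<open>U \<noteq> {}\<close>] unfolding t'_def by blast
    then have rw: "r j < w" if "j \<in> G" for j
    proof -
      have "r j \<le> Max (r ` G)" using that fin(2) by (intro Max_ge) auto
      then show ?thesis using w(2) by linarith
    qed
    have "w \<le> t'" unfolding t'_def using w(1) bdd by (rule cSup_upper)
    have G_live: "G \<subseteq> alg.live x" if "w \<le> x" "x \<le> t'" for x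
      using that rw alg.rem_antimono[of _ x t'] by (force simp: G_def alg.live_iff)
    have "card (small w) < card G" using w(1) \<open>\<not> card G \<le> m\<close> by (simp add: U_def)
    then have "\<not> G \<subseteq> small w" using card_mono[of "small w" G] by (auto simp: small_def)
    then obtain j0 where "j0 \<in> G" "j0 \<notin> small w" by blast
    then have j0: "j0 \<in> G" "y < alg.rem j0 w"
      using G_live[of w] \<open>w \<le> t'\<close> by (auto simp: small_def)
    have "i < n \<and> r i \<le> w" if "i \<in> G" for i
      using rw[OF that] that by (simp add: G_def less_imp_le)
    with alg.ex_last[of G w] fin(2) \<open>G \<noteq> {}\<close>
    obtain j where j: "j \<in> G" "\<And>i. i \<in> G \<Longrightarrow> alg.ahead w i j" by blast
    have "y < alg.rem j w" using alg.aheadD[OF j(2)[OF j0(1)], of w] j0 by simp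
    have "alg.work j w t' = 0"
    proof (rule alg.work_eq_0[OF _ alg.negligible_ties])
      fix x assume x: "w < x" "x < t'" "x \<notin> alg.ties"
      show "x \<notin> alg.busy j"
      proof
        assume "x \<in> alg.busy j"
        then have "j \<in> alg.proc x" by (simp add: alg.busy_def)
        have "card (alg.proc x) < card G" using alg.card_proc_le[of x] \<open>\<not> card G \<le> m\<close> by linarith
        then have "\<not> G \<subseteq> alg.proc x" by (meson alg.finite_proc card_mono not_less)
        then obtain i where "i \<in> G" "i \<notin> alg.proc x" by blast
        moreover from this have "i \<in> alg.live x" using G_live[of x] x by auto
        ultimately show False
          using alg.proc_rem_less[OF x(3) \<open>j \<in> alg.proc x\<close>, of i] alg.aheadD[OF j(2)[of i], of x] x by simp
      qed
    qed
    then show False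
      using alg.rem_diff[of j w t'] j(1) \<open>w \<le> t'\<close> \<open>y < alg.rem j w\<close> by (simp add: G_def)
  qed

  have full: "m < card (small x)" if "t' < x" "x < t" for x
  proof (rule ccontr)
    assume "\<not> m < card (small x)"
    then have "x \<in> U" using that by (simp add: U_def)
    then have "x \<le> t'" unfolding t'_def using bdd by (intro cSup_upper)
    then show False using that by simp
  qed
  have full': "card (alg.proc x) = m \<and> (\<forall>i\<in>alg.proc x. alg.rem i x \<le> y)" if "t' < x" "x < t" for x
  proof -
    have "\<not> small x \<subseteq> alg.proc x"
      using full[OF that] alg.card_proc_le[of x] card_mono[OF alg.finite_proc, of "small x" x] by linarith
    then obtain j where "j \<in> alg.live x" "alg.rem j x \<le> y" "j \<notin> alg.proc x" by (auto simp: small_def)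
    then show ?thesis using alg.card_proc_if_waiting alg.proc_rem_le by (blast intro: order.trans)
  qed
  \<comment> \<open>After \<open>t'\<close> only jobs with remaining time at most \<open>y\<close>
    are run, so a larger one is frozen and never becomes small.\<close>
  have big: "y < alg.rem j b" if j: "j < n" "t' \<le> a" "a \<le> b" "b \<le> t" "y < alg.rem j a" for j a b
  proof -
    have "0 < alg.rem j b - y"
    proof (rule positive_persists[where f = "\<lambda>x. alg.rem j x - y" and a = a])
      fix c assume c: "a < c" "c \<le> b" "\<And>x. a \<le> x \<Longrightarrow> x < c \<Longrightarrow> 0 < alg.rem j x - y"
      have "alg.work j a c = 0"
      proof (rule alg.work_eq_0[OF _ negligible_empty])
        fix x assume x: "a < x" "x < c"
        then have "\<forall>i\<in>alg.proc x. alg.rem i x \<le> y" using c j full'[of x] by simp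
        then show "x \<notin> alg.busy j" using c(3)[of x] x by (auto simp: alg.busy_def)
      qed
      then show "0 < alg.rem j c - y" using alg.rem_diff[of j a c] j c by simp
    qed (use j alg.continuous_rem in \<open>auto intro: continuous_intros\<close>)
    then show ?thesis by simp
  qed
  have proc_sub: "alg.proc x \<subseteq> G \<union> New" if x: "t' < x" "x < t" for x
  proof
    fix i assume i: "i \<in> alg.proc x"
    then have "i < n" "r i \<le> x" "0 < alg.rem i x" using alg.proc_live[OF i] by (auto simp: alg.live_iff)
    moreover have "alg.rem i x \<le> y" using full'[OF x] i by blast
    ultimately show "i \<in> G \<union> New"
      using big[of i t' x] big[of i "r i" x] alg.rem_antimono[of i t' x] x J(3)[of i]
      by (cases "r i < t'") (auto simp: G_def New_def not_less[symmetric])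
  qed
  have work: "s * real m * (t - t') \<le> (\<Sum>i\<in>G \<union> New. alg.work i t' t)"
  proof (rule alg.sum_work_ge[OF sub t'])
    show "negligible (r ` {..<n})" by (simp add: negligible_finite)
    fix x assume x: "t' < x" "x < t" "x \<notin> r ` {..<n}"
    have "alg.proc x \<subseteq> {i \<in> G \<union> New. x \<in> alg.busy i}"
      using proc_sub[OF x(1,2)] alg.proc_eq_busy[OF x(3)] by blast
    then have "card (alg.proc x) \<le> card {i \<in> G \<union> New. x \<in> alg.busy i}"
      using fin by (intro card_mono) auto
    then show "m \<le> card {i \<in> G \<union> New. x \<in> alg.busy i}" using full'[OF x(1,2)] by simp
  qed

  \<comment> \<open>A small job outside \<open>G\<close> and \<open>New\<close> has nothing left:
    were it unfinished at \<open>t'\<close>, it would be in \<open>G\<close>, or too large to become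
    small later.\<close>
  have "(\<Sum>j | j \<in> J \<and> alg.rem j t \<le> y. alg.rem j t)
      = (\<Sum>j \<in> {j. j \<in> J \<and> alg.rem j t \<le> y} \<inter> (G \<union> New). alg.rem j t)"
  proof (rule sum.mono_neutral_right)
    show "\<forall>j\<in>{j. j \<in> J \<and> alg.rem j t \<le> y} - {j. j \<in> J \<and> alg.rem j t \<le> y} \<inter> (G \<union> New). alg.rem j t = 0"
    proof
      fix j assume j: "j \<in> {j. j \<in> J \<and> alg.rem j t \<le> y} - {j. j \<in> J \<and> alg.rem j t \<le> y} \<inter> (G \<union> New)"
      then have jn: "j < n" "alg.rem j t \<le> y" "r j \<le> t" "j \<notin> G" "j \<notin> New" "j \<in> J" using J by auto
      have "r j < t'"
        using big[of j "r j" t] jn by (auto simp: New_def not_less[symmetric])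
      then have "alg.rem j t' \<le> 0"
        using big[of j t' t] jn t' by (auto simp: G_def not_less[symmetric])
      then show "alg.rem j t = 0"
        using alg.rem_antimono[of j t' t] alg.rem_nonneg[of j t] jn t' by simp
    qed
  qed (use fin in auto)
  also have "\<dots> \<le> (\<Sum>j\<in>G \<union> New. alg.rem j t)"
    using fin sub alg.rem_nonneg by (intro sum_mono2) auto
  also have "\<dots> = (\<Sum>j\<in>G \<union> New. alg.rem j t') - (\<Sum>j\<in>G \<union> New. alg.work j t' t)"
    unfolding sum_subtractf[symmetric]
    using alg.rem_diff[of _ t' t] t' sub by (intro sum.cong) (auto simp: algebra_simps)
  also have "(\<Sum>j\<in>G \<union> New. alg.rem j t') = (\<Sum>j\<in>G. alg.rem j t') + (\<Sum>j\<in>New. alg.rem j t')"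
    using fin by (intro sum.union_disjoint) (auto simp: G_def New_def)
  also have "(\<Sum>j\<in>G. alg.rem j t') \<le> real (card G) * y"
    by (intro sum_bounded_above) (simp add: G_def)
  also have "real (card G) * y \<le> real m * y"
    using cardG \<open>0 < y\<close> by simp
  also have "(\<Sum>j\<in>New. alg.rem j t') \<le> (\<Sum>j\<in>New. p j)"
    using sub alg.rem_le_p by (intro sum_mono) auto
  finally have *: "(\<Sum>j | j \<in> J \<and> alg.rem j t \<le> y. alg.rem j t)
      \<le> real m * y + (\<Sum>j\<in>New. p j) - s * real m * (t - t')" using work by linarith

  \<comment> \<open>The optimum can start on \<open>New\<close> only after \<open>t'\<close> and
    works at rate at most \<open>m\<close>; what is left of these jobs is small for it too, as
    \<open>p j\<close> is at most \<open>y\<close>.\<close>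
  have "(\<Sum>j\<in>New. p j) - real m * (t - t') \<le> (\<Sum>j\<in>New. p j) - (\<Sum>j\<in>New. opt.work j t' t)"
    using opt.sum_work_le[of New t' t] sub t' by simp
  also have "\<dots> = (\<Sum>j\<in>New. opt.rem j t)"
    unfolding sum_subtractf[symmetric]
  proof (rule sum.cong)
    fix j assume "j \<in> New"
    moreover from this have "j < n" using sub by auto
    ultimately show "p j - opt.work j t' t = opt.rem j t"
      using opt.rem_diff[of j t' t] opt.rem_before[of t' j] t' by (simp add: New_def)
  qed simp
  also have "\<dots> \<le> (\<Sum>j | j \<in> J \<and> opt.rem j t \<le> y. opt.rem j t)"
  proof (rule sum_mono2)
    show "New \<subseteq> {j. j \<in> J \<and> opt.rem j t \<le> y}"
    proof
      fix j assume "j \<in> New"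
      moreover from this have "j < n" using sub by auto
      ultimately show "j \<in> {j. j \<in> J \<and> opt.rem j t \<le> y}"
        using opt.rem_le_p[of j t] by (simp add: New_def)
    qed
  qed (use fin J opt.rem_nonneg in auto)
  finally have "(\<Sum>j\<in>New. p j) - real m * (t - t') \<le> \<dots>" .
  moreover have "real m * (t - t') \<le> s * real m * (t - t')"
    using mult_right_mono[OF \<open>1 \<le> s\<close>, of "real m * (t - t')"] t' by (simp add: mult.assoc)
  ultimately show ?thesis using * by linarith
qed

end

section \<open>Truncated volume at speed at least 2\<close>


context srpt_and_optimum
begin

text \<open>
  \<open>L\<close> is matched with a set of jobs that SRPT puts first.  On these, SRPT leads the optimum in total
  volume by \<open>m M\<close>, and lags behind on a single matched pair by at most \<open>M\<close>.  For \<open>s \<ge> 2\<close> this is preserved: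
  while all machines work on matched jobs, the lead in volume grows at least as fast as any lag; while some
  machine does not, all matched live jobs are processed and catch up at least as fast as the lead shrinks.
\<close>

definition dominates :: "(nat \<Rightarrow> nat) \<Rightarrow> real \<Rightarrow> nat set \<Rightarrow> nat set \<Rightarrow> real \<Rightarrow> bool" where
  "dominates \<phi> M L J u \<longleftrightarrow> inj_on \<phi> L \<and> \<phi> ` L \<subseteq> J \<and> 0 \<le> M \<and>
     (\<Sum>j\<in>L. alg.rem (\<phi> j) u) + real m * M \<le> (\<Sum>j\<in>L. opt.rem j u) \<and>
     (\<forall>j\<in>L. alg.rem (\<phi> j) u \<le> opt.rem j u + M) \<and>
     (\<forall>i\<in>J - \<phi> ` L. \<forall>j\<in>\<phi> ` L. alg.ahead u j i)"

text \<open>On matched jobs SRPT does work at least \<open>2 * m * (v - u)\<close>, the optimum at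
  most \<open>m * (v - u)\<close>, so the lead grows enough for \<open>M\<close> to grow by
  \<open>v - u\<close>. No single lag grows faster, because the optimum runs a job at rate at most
  1.\<close>

lemma dominates_full:
  assumes dom: "dominates \<phi> M L J u" and "L \<subseteq> J" "J \<subseteq> {..<n}" "u \<le> v" "2 \<le> s"
    and live: "\<And>w. u < w \<Longrightarrow> w < v \<Longrightarrow> alg.live w \<subseteq> J"
    and full: "\<And>w. u < w \<Longrightarrow> w < v \<Longrightarrow> m \<le> card (\<phi> ` L \<inter> alg.live w)"
  shows "dominates \<phi> (M + (v - u)) L J v"
proof -
  note d = dom[unfolded dominates_def]
  have fin: "finite L" using assms(2,3) by (meson finite_lessThan finite_subset)
  have sub: "\<phi> ` L \<subseteq> {..<n}" "L \<subseteq> {..<n}" using d assms(2,3) by auto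
  have "s * real m * (v - u) \<le> (\<Sum>j\<in>\<phi> ` L. alg.work j u v)"
  proof (rule alg.sum_work_ge[OF sub(1) \<open>u \<le> v\<close>])
    show "negligible (alg.ties \<union> r ` {..<n})" using alg.negligible_ties by (simp add: negligible_finite)
    fix w assume w: "u < w" "w < v" "w \<notin> alg.ties \<union> r ` {..<n}"
    have "alg.proc w \<subseteq> \<phi> ` L \<and> m \<le> card (alg.proc w)"
    \<comment> \<open>If no matched live job waits, they fill the machines by \<open>full\<close>.
      If one waits, only matched jobs are run, because unmatched ones are behind it and ties are
      excluded.\<close>
    proof (cases "\<phi> ` L \<inter> alg.live w \<subseteq> alg.proc w")
      case True
      have "m \<le> card (alg.proc w)"
        using full[OF w(1,2)] card_mono[OF alg.finite_proc True] by linarith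
      moreover have "\<phi> ` L \<inter> alg.live w = alg.proc w"
        using True full[OF w(1,2)] alg.card_proc_le[of w] by (intro card_seteq) auto
      ultimately show ?thesis by blast
    next
      case False
      then obtain j where j: "j \<in> \<phi> ` L" "j \<in> alg.live w" "j \<notin> alg.proc w" by blast
      have "i \<in> \<phi> ` L" if i: "i \<in> alg.proc w" for i
      proof (rule ccontr)
        assume "i \<notin> \<phi> ` L"
        moreover have "i \<in> J" using live[OF w(1,2)] alg.proc_live[OF i] by blast
        ultimately have "alg.rem j w \<le> alg.rem i w"
          using d j(1) w(1) by (intro alg.aheadD[of u j i]) auto
        then show False using alg.proc_rem_less[of w i j] w i j by simp
      qed
      then show ?thesis using alg.card_proc_if_waiting[OF j(2,3)] by auto
    qed
    moreover have "alg.proc w \<subseteq> {j. w \<in> alg.busy j}" using alg.proc_eq_busy[of w] w(3) by blast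
    ultimately have "alg.proc w \<subseteq> {j \<in> \<phi> ` L. w \<in> alg.busy j}" "m \<le> card (alg.proc w)" by auto
    then show "m \<le> card {j \<in> \<phi> ` L. w \<in> alg.busy j}"
      using card_mono[of "{j \<in> \<phi> ` L. w \<in> alg.busy j}" "alg.proc w"] fin by auto
  qed
  also have "\<dots> = (\<Sum>j\<in>L. alg.work (\<phi> j) u v)"
    using d by (simp add: sum.reindex)
  also have "\<dots> = (\<Sum>j\<in>L. alg.rem (\<phi> j) u) - (\<Sum>j\<in>L. alg.rem (\<phi> j) v)"
    unfolding sum_subtractf[symmetric] using alg.rem_diff \<open>u \<le> v\<close> sub by (intro sum.cong) auto
  finally have 1: "(\<Sum>j\<in>L. alg.rem (\<phi> j) v) \<le> (\<Sum>j\<in>L. alg.rem (\<phi> j) u) - s * real m * (v - u)" by simp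
  have "(\<Sum>j\<in>L. opt.rem j u) - (\<Sum>j\<in>L. opt.rem j v) = (\<Sum>j\<in>L. opt.work j u v)"
    unfolding sum_subtractf[symmetric] using opt.rem_diff \<open>u \<le> v\<close> sub by (intro sum.cong) auto
  also have "\<dots> \<le> real m * (v - u)" using opt.sum_work_le[OF sub(2) \<open>u \<le> v\<close>] by simp
  finally have 2: "(\<Sum>j\<in>L. opt.rem j u) - real m * (v - u) \<le> (\<Sum>j\<in>L. opt.rem j v)" by simp
  have "2 * (real m * (v - u)) \<le> s * (real m * (v - u))"
    using \<open>2 \<le> s\<close> \<open>u \<le> v\<close> by (intro mult_right_mono) auto
  then have "(\<Sum>j\<in>L. alg.rem (\<phi> j) v) + real m * (M + (v - u)) \<le> (\<Sum>j\<in>L. opt.rem j v)"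
    using 1 2 d by (simp add: algebra_simps)
  moreover have "alg.rem (\<phi> j) v \<le> opt.rem j v + (M + (v - u))" if "j \<in> L" for j
  proof -
    have "alg.rem (\<phi> j) v \<le> alg.rem (\<phi> j) u" using that sub \<open>u \<le> v\<close> by (intro alg.rem_antimono) auto
    also have "\<dots> \<le> opt.rem j u + M" using d that by blast
    also have "opt.rem j u \<le> opt.rem j v + (v - u)"
      using opt.rem_diff[of j u v] opt.work_le_time[of j u v] that sub \<open>u \<le> v\<close> by auto
    finally show ?thesis by simp
  qed
  ultimately show ?thesis
    using d \<open>u \<le> v\<close> alg.ahead_later[OF _ \<open>u \<le> v\<close>] by (auto simp: dominates_def)
qed

text \<open>Matched jobs still alive at \<open>v\<close> are run throughout, so each lag shrinks by
  at least \<open>v - u\<close>, while the lead per machine shrinks by at most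
  \<open>v - u\<close>.\<close>

lemma dominates_not_full:
  assumes dom: "dominates \<phi> M L J u" and "L \<subseteq> J" "J \<subseteq> {..<n}" "\<And>j. j \<in> J \<Longrightarrow> r j \<le> u" "u \<le> v" "2 \<le> s"
    and live: "\<And>w. u < w \<Longrightarrow> w < v \<Longrightarrow> alg.live w \<subseteq> J"
    and not_full: "\<And>w. u < w \<Longrightarrow> w < v \<Longrightarrow> card (\<phi> ` L \<inter> alg.live w) < m"
  shows "\<exists>M'. dominates \<phi> M' L J v"
proof -
  note d = dom[unfolded dominates_def]
  have fin: "finite L" using assms(2,3) by (meson finite_lessThan finite_subset)
  have sub: "\<phi> ` L \<subseteq> {..<n}" "L \<subseteq> {..<n}" using d assms(2,3) by auto
  have m: "0 < real m" using alg.m_pos by simp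
  have dec: "alg.rem (\<phi> j) v \<le> alg.rem (\<phi> j) u - 2 * (v - u)" if j: "j \<in> L" "0 < alg.rem (\<phi> j) v" for j
  proof -
    have jn: "\<phi> j < n" "r (\<phi> j) \<le> u" "\<phi> j \<in> J" using j d assms(3,4) by auto
    have "s * real 1 * (v - u) \<le> (\<Sum>i\<in>{\<phi> j}. alg.work i u v)"
    proof (rule alg.sum_work_ge[OF _ \<open>u \<le> v\<close> alg.negligible_ties])
      fix w assume w: "u < w" "w < v" "w \<notin> alg.ties"
      have lw: "\<phi> j \<in> alg.live w"
        using jn w j(2) alg.rem_antimono[of "\<phi> j" w v] by (simp add: alg.live_iff)
      have "\<phi> j \<in> alg.proc w"
      proof (rule ccontr)
        assume np: "\<phi> j \<notin> alg.proc w"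
        then have "card (alg.proc w) = m" using lw by (rule alg.card_proc_if_waiting[rotated])
        then have "\<not> alg.proc w \<subseteq> \<phi> ` L \<inter> alg.live w"
          using not_full[OF w(1,2)] card_mono[of "\<phi> ` L \<inter> alg.live w" "alg.proc w"] by auto
        then obtain i where i: "i \<in> alg.proc w" "i \<notin> \<phi> ` L" using alg.proc_live by blast
        then have "i \<in> J" using live[OF w(1,2)] alg.proc_live by blast
        then have "alg.rem (\<phi> j) w \<le> alg.rem i w"
          using d i(2) j(1) w(1) by (intro alg.aheadD[of u "\<phi> j" i]) auto
        then show False using alg.proc_rem_less[OF w(3) i(1) lw np] by simp
      qed
      then have "{i \<in> {\<phi> j}. w \<in> alg.busy i} = {\<phi> j}" using w jn by (auto simp: alg.busy_def)
      then show "1 \<le> card {i \<in> {\<phi> j}. w \<in> alg.busy i}" by simp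
    qed (use jn in auto)
    moreover have "2 * (v - u) \<le> s * (v - u)" using \<open>2 \<le> s\<close> \<open>u \<le> v\<close> by (intro mult_right_mono) auto
    ultimately show ?thesis using alg.rem_diff[OF jn(1) \<open>u \<le> v\<close>] by simp
  qed
  \<comment> \<open>This value turns the condition on the total volume into an equality.\<close>
  define M' where "M' = ((\<Sum>j\<in>L. opt.rem j v) - (\<Sum>j\<in>L. alg.rem (\<phi> j) v)) / real m"
  have M': "real m * M' = (\<Sum>j\<in>L. opt.rem j v) - (\<Sum>j\<in>L. alg.rem (\<phi> j) v)"
    using m by (simp add: M'_def)
  have "(\<Sum>j\<in>L. opt.rem j u) - (\<Sum>j\<in>L. opt.rem j v) = (\<Sum>j\<in>L. opt.work j u v)"
    unfolding sum_subtractf[symmetric] using opt.rem_diff \<open>u \<le> v\<close> sub by (intro sum.cong) auto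
  also have "\<dots> \<le> real m * (v - u)" using opt.sum_work_le[OF sub(2) \<open>u \<le> v\<close>] by simp
  finally have "(\<Sum>j\<in>L. opt.rem j u) - real m * (v - u) \<le> (\<Sum>j\<in>L. opt.rem j v)" by simp
  moreover have "(\<Sum>j\<in>L. alg.rem (\<phi> j) v) \<le> (\<Sum>j\<in>L. alg.rem (\<phi> j) u)"
    using alg.rem_antimono \<open>u \<le> v\<close> sub by (intro sum_mono) auto
  ultimately have "real m * (M - (v - u)) \<le> real m * M'"
    using d M' by (simp add: algebra_simps)
  then have MM': "M - (v - u) \<le> M'" using m by simp
  have pos: "alg.rem (\<phi> j) v \<le> opt.rem j v + M'" if j: "j \<in> L" "0 < alg.rem (\<phi> j) v" for j
  proof -
    have "alg.rem (\<phi> j) u \<le> opt.rem j u + M" using d j(1) by blast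
    moreover have "opt.rem j u \<le> opt.rem j v + (v - u)"
      using opt.rem_diff[of j u v] opt.work_le_time[of j u v] j(1) sub \<open>u \<le> v\<close> by auto
    moreover have "alg.rem (\<phi> j) v + 2 * (v - u) \<le> alg.rem (\<phi> j) u" using dec[OF j] by simp
    ultimately show ?thesis using MM' \<open>u \<le> v\<close> by simp
  qed
  \<comment> \<open>A negative \<open>M'\<close> would leave SRPT no lag on any pair, and then the
    total lead could not be negative.\<close>
  have "0 \<le> M'"
  proof (rule ccontr)
    assume neg: "\<not> 0 \<le> M'"
    have "alg.rem (\<phi> j) v \<le> opt.rem j v" if "j \<in> L" for j
      using pos[OF that] neg opt.rem_nonneg[of j v] sub that by (cases "0 < alg.rem (\<phi> j) v") (auto simp: not_less intro: order.trans)
    then have "0 \<le> real m * M'" unfolding M' by (simp add: sum_mono)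
    then show False using neg m by (simp add: zero_le_mult_iff)
  qed
  moreover have "alg.rem (\<phi> j) v \<le> opt.rem j v + M'" if "j \<in> L" for j
    using pos[OF that] \<open>0 \<le> M'\<close> opt.rem_nonneg[of j v] sub that by (cases "0 < alg.rem (\<phi> j) v") auto
  ultimately have "dominates \<phi> M' L J v"
    using d M' alg.ahead_later[OF _ \<open>u \<le> v\<close>] by (auto simp: dominates_def)
  then show ?thesis by blast
qed

text \<open>All jobs of \<open>J\<close> are released by \<open>u\<close>, so the number of matched
  live jobs only decreases. The interval splits at the last time this number is at least
  \<open>m\<close>.\<close>

lemma dominates_evolves:
  assumes dom: "dominates \<phi> M L J u" and L: "L \<subseteq> J" and J: "J \<subseteq> {..<n}" "\<And>j. j \<in> J \<Longrightarrow> r j \<le> u"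
    and "u \<le> v" "2 \<le> s" and live: "\<And>w. u < w \<Longrightarrow> w < v \<Longrightarrow> alg.live w \<subseteq> J"
  shows "\<exists>M'. dominates \<phi> M' L J v"
proof -
  define cnt where "cnt w = card (\<phi> ` L \<inter> alg.live w)" for w
  \<comment> \<open>Inserting \<open>u\<close> keeps the set nonempty; if the matched jobs never
    suffice for \<open>m\<close> machines, the first phase is empty.\<close>
  define F where "F = insert u {w. u \<le> w \<and> w \<le> v \<and> m \<le> cnt w}"
  define \<tau> where "\<tau> = Sup F"
  have imJ: "\<phi> ` L \<subseteq> J" using dom by (auto simp: dominates_def)
  have mono: "cnt w' \<le> cnt w" if "u \<le> w" "w \<le> w'" for w w'
    unfolding cnt_def
  proof (rule card_mono)
    show "\<phi> ` L \<inter> alg.live w' \<subseteq> \<phi> ` L \<inter> alg.live w"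
      using imJ J that alg.rem_antimono[of _ w w'] by (force simp: alg.live_iff)
  qed simp
  have F: "F \<subseteq> {u..v}" "F \<noteq> {}" "bdd_above F" using \<open>u \<le> v\<close> by (auto simp: F_def bdd_above_def)
  have \<tau>: "u \<le> \<tau>" "\<tau> \<le> v"
    unfolding \<tau>_def using F by (auto intro!: cSup_upper cSup_least simp: F_def)
  have "m \<le> cnt w" if w: "u < w" "w < \<tau>" for w
  proof -
    obtain w' where "w' \<in> F" "w < w'" using less_cSupD[OF F(2)] w(2) unfolding \<tau>_def by blast
    then show ?thesis using mono[of w w'] w by (auto simp: F_def)
  qed
  then have 1: "dominates \<phi> (M + (\<tau> - u)) L J \<tau>"
    using assms \<tau> by (intro dominates_full) (auto simp: cnt_def)
  have 2: "cnt w < m" if w: "\<tau> < w" "w < v" for w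
  proof (rule ccontr)
    assume "\<not> cnt w < m"
    then have "w \<in> F" using w \<tau> by (auto simp: F_def)
    then have "w \<le> \<tau>" unfolding \<tau>_def using F(3) by (intro cSup_upper)
    then show False using w by simp
  qed
  show ?thesis
  proof (rule dominates_not_full[OF 1 L J(1) _ \<tau>(2) \<open>2 \<le> s\<close>])
    show "r j \<le> \<tau>" if "j \<in> J" for j using J(2)[OF that] \<tau> by simp
  qed (use live \<tau> 2 in \<open>auto simp: cnt_def\<close>)
qed

text \<open>The new job \<open>a\<close> is matched with the first job \<open>e\<close> among
  \<open>a\<close> and the unmatched ones. Its remaining time is at most \<open>p a\<close>, and the
  matched jobs stay an initial segment.\<close>

lemma dominates_insert_both:
  assumes dom: "dominates \<phi> M L J u" and J: "L \<subseteq> J" "J \<subseteq> {..<n}" "\<And>j. j \<in> J \<Longrightarrow> r j \<le> u"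
    and a: "a < n" "a \<notin> J" "r a = u"
  shows "\<exists>\<psi>. dominates \<psi> M (insert a L) (insert a J) u"
proof -
  have inj: "inj_on \<phi> L" and img: "\<phi> ` L \<subseteq> J" and M: "0 \<le> M"
    and total: "(\<Sum>j\<in>L. alg.rem (\<phi> j) u) + real m * M \<le> (\<Sum>j\<in>L. opt.rem j u)"
    and each: "\<And>j. j \<in> L \<Longrightarrow> alg.rem (\<phi> j) u \<le> opt.rem j u + M"
    and prefix: "\<And>i j. i \<in> J \<Longrightarrow> i \<notin> \<phi> ` L \<Longrightarrow> j \<in> \<phi> ` L \<Longrightarrow> alg.ahead u j i"
    using dom unfolding dominates_def by blast+
  have fin: "finite J" "finite L" using J by (auto intro: finite_subset)
  have "\<exists>e\<in>insert a (J - \<phi> ` L). \<forall>j\<in>insert a (J - \<phi> ` L). alg.ahead u e j"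
    using fin J a by (intro alg.ex_first) auto
  then obtain e where e: "e \<in> insert a (J - \<phi> ` L)" "\<And>j. j \<in> insert a (J - \<phi> ` L) \<Longrightarrow> alg.ahead u e j"
    by blast
  define \<psi> where "\<psi> = \<phi>(a := e)"
  have aL: "a \<notin> L" using J a by auto
  have \<psi>: "\<psi> a = e" "\<And>j. j \<in> L \<Longrightarrow> \<psi> j = \<phi> j" using aL by (auto simp: \<psi>_def)
  have im: "\<psi> ` insert a L = insert e (\<phi> ` L)" using aL by (auto simp: \<psi>_def)
  have ne: "e \<notin> \<phi> ` L" using e(1) img a(2) by auto
  have pa: "alg.rem a u = p a" "opt.rem a u = p a" using a alg.rem_release[of a] opt.rem_release[of a] by auto
  have ea: "alg.rem e u \<le> p a" using alg.aheadD[OF e(2)[of a], of u] pa by simp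
  have L: "\<psi> ` L = \<phi> ` L" "inj_on \<psi> L"
    using \<psi>(2) inj by (auto cong: inj_on_cong image_cong)
  then have "inj_on \<psi> (insert a L)"
    using ne aL \<psi>(1) by simp
  moreover have "(\<Sum>j\<in>insert a L. alg.rem (\<psi> j) u) + real m * M \<le> (\<Sum>j\<in>insert a L. opt.rem j u)"
    using total aL fin ea pa \<psi> by (simp cong: sum.cong)
  moreover have "alg.ahead u j i"
    if i: "i \<in> insert a J - insert e (\<phi> ` L)" and j: "j \<in> insert e (\<phi> ` L)" for i j
  proof (cases "j = e")
    case True then show ?thesis using e(2) i by auto
  next
    case False
    then have j': "j \<in> \<phi> ` L" using j by simp
    show ?thesis
    proof (cases "i = a")
      case True
      then have "e \<in> J - \<phi> ` L" using e(1) i by auto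
      then have "alg.ahead u j e" using prefix j' by blast
      then show ?thesis using alg.ahead_trans e(2)[of a] True by blast
    next
      case False then show ?thesis using prefix i j' by blast
    qed
  qed
  moreover have "alg.rem (\<psi> j) u \<le> opt.rem j u + M" if "j \<in> insert a L" for j
    using that each[of j] ea pa M \<psi> by auto
  moreover have "insert e (\<phi> ` L) \<subseteq> insert a J" using e(1) img by blast
  ultimately have "dominates \<psi> M (insert a L) (insert a J) u"
    unfolding dominates_def im using M by blast
  then show ?thesis by blast
qed

text \<open>If \<open>a\<close> comes after all matched jobs, the matching stays. Otherwise
  \<open>a\<close> replaces the last matched job \<open>e\<close>, which can only decrease the
  volume of SRPT.\<close>

lemma dominates_insert_right:
  assumes dom: "dominates \<phi> M L J u" and J: "L \<subseteq> J" "J \<subseteq> {..<n}" "\<And>j. j \<in> J \<Longrightarrow> r j \<le> u"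
    and a: "a < n" "a \<notin> J" "r a = u"
  shows "\<exists>\<psi>. dominates \<psi> M L (insert a J) u"
proof -
  have inj: "inj_on \<phi> L" and img: "\<phi> ` L \<subseteq> J" and M: "0 \<le> M"
    and total: "(\<Sum>j\<in>L. alg.rem (\<phi> j) u) + real m * M \<le> (\<Sum>j\<in>L. opt.rem j u)"
    and each: "\<And>j. j \<in> L \<Longrightarrow> alg.rem (\<phi> j) u \<le> opt.rem j u + M"
    and prefix: "\<And>i j. i \<in> J \<Longrightarrow> i \<notin> \<phi> ` L \<Longrightarrow> j \<in> \<phi> ` L \<Longrightarrow> alg.ahead u j i"
    using dom unfolding dominates_def by blast+
  have fin: "finite J" "finite L" using J by (auto intro: finite_subset)
  have "\<exists>e\<in>insert a (\<phi> ` L). \<forall>j\<in>insert a (\<phi> ` L). alg.ahead u j e"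
    using fin J a img by (intro alg.ex_last) auto
  then obtain e where e: "e \<in> insert a (\<phi> ` L)" "\<And>j. j \<in> insert a (\<phi> ` L) \<Longrightarrow> alg.ahead u j e"
    by blast
  show ?thesis
  proof (cases "e = a")
    case True
    then have "dominates \<phi> M L (insert a J) u"
      unfolding dominates_def using inj img M total each prefix e(2) by blast
    then show ?thesis by blast
  next
    case False
    then obtain k where k: "k \<in> L" "\<phi> k = e" using e(1) by auto
    define \<psi> where "\<psi> = \<phi>(k := a)"
    have anot: "a \<notin> \<phi> ` L" using img a(2) by auto
    have ae: "alg.ahead u a e" using e(2) by simp
    then have le: "alg.rem (\<psi> j) u \<le> alg.rem (\<phi> j) u" for j
      using alg.aheadD[OF ae, of u] k by (simp add: \<psi>_def)
    have im: "\<psi> ` L = insert a (\<phi> ` L - {e})"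
      using inj k by (auto simp: \<psi>_def inj_on_def)
    have "inj_on \<psi> L" using inj anot unfolding \<psi>_def by (rule inj_on_fun_updI)
    moreover have "(\<Sum>j\<in>L. alg.rem (\<psi> j) u) \<le> (\<Sum>j\<in>L. alg.rem (\<phi> j) u)"
      using le by (intro sum_mono)
    then have "(\<Sum>j\<in>L. alg.rem (\<psi> j) u) + real m * M \<le> (\<Sum>j\<in>L. opt.rem j u)"
      using total by linarith
    moreover have "alg.rem (\<psi> j) u \<le> opt.rem j u + M" if "j \<in> L" for j
      using le[of j] each[OF that] by linarith
    moreover have "alg.ahead u j i"
      if i: "i \<in> insert a J - insert a (\<phi> ` L - {e})" and j: "j \<in> insert a (\<phi> ` L - {e})" for i j
    proof (cases "i = e")
      case True then show ?thesis using e(2) j by auto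
    next
      case False
      then have i': "i \<in> J - \<phi> ` L" using i by auto
      have "alg.ahead u e i" using prefix i' k by blast
      then show ?thesis using alg.ahead_trans e(2)[of j] j by blast
    qed
    moreover have "insert a (\<phi> ` L - {e}) \<subseteq> insert a J" using img by blast
    ultimately have "dominates \<psi> M L (insert a J) u"
      unfolding dominates_def im using M by blast
    then show ?thesis by blast
  qed
qed

section \<open>Adding the jobs in order of release\<close>

text \<open>Ties are broken by index so that jobs released together are inserted one at a
  time.\<close>

definition earlier :: "nat \<Rightarrow> nat set" where
  "earlier j = {i. i < n \<and> (r i < r j \<or> r i = r j \<and> i < j)}"

lemma earlier_lt: "i \<in> earlier j \<Longrightarrow> i < n" and earlier_le: "i \<in> earlier j \<Longrightarrow> r i \<le> r j"
  by (auto simp: earlier_def)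

lemma finite_earlier [simp]: "finite (earlier j)"
  by (rule finite_subset[of _ "{..<n}"]) (auto dest: earlier_lt)

lemma earlier_linear: "i < n \<Longrightarrow> j < n \<Longrightarrow> i \<in> earlier j \<or> i = j \<or> j \<in> earlier i"
  by (auto simp: earlier_def)

lemma earlier_asym: "i \<in> earlier j \<Longrightarrow> j \<notin> earlier i"
  by (auto simp: earlier_def)

lemma earlier_irrefl [simp]: "i \<notin> earlier i"
  by (auto simp: earlier_def)

text \<open>Induction along the release order: the claim for the last job \<open>a\<close> before
  \<open>j\<close> holds at \<open>r a\<close>; then \<open>a\<close> is inserted, on the side of
  the optimum only if it lies in \<open>K\<close>. No further job is released before
  \<open>r j\<close>, so the matching evolves up to that time.\<close>

lemma ex_dominates_earlier:
  assumes "2 \<le> s"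
  shows "\<exists>\<phi> M. dominates \<phi> M (K \<inter> earlier j) (earlier j) (r j)"
proof (induction "card (earlier j)" arbitrary: j rule: less_induct)
  case less
  show ?case
  proof (cases "earlier j = {}")
    case True
    then show ?thesis by (intro exI[of _ 0] exI) (simp add: dominates_def)
  next
    case False
    define R where "R = Max (r ` earlier j)"
    define a where "a = Max {i \<in> earlier j. r i = R}"
    have "R \<in> r ` earlier j" unfolding R_def using False by (intro Max_in) auto
    then have "a \<in> {i \<in> earlier j. r i = R}" unfolding a_def by (intro Max_in) auto
    then have a: "a \<in> earlier j" "r a = R" by auto
    have le_R: "r i \<le> R" if "i \<in> earlier j" for i unfolding R_def using that by simp
    have le_a: "i \<le> a" if "i \<in> earlier j" "r i = R" for i unfolding a_def using that by simp
    have ej: "earlier j = insert a (earlier a)"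
    proof (intro set_eqI iffI)
      fix i assume i: "i \<in> earlier j"
      then show "i \<in> insert a (earlier a)"
        using earlier_lt[OF i] le_R[OF i] le_a[OF i] a(2) by (auto simp: earlier_def)
    next
      fix i assume "i \<in> insert a (earlier a)"
      then show "i \<in> earlier j" using a(1) by (auto simp: earlier_def)
    qed
    have an: "a < n" "r a \<le> r j" using a(1) earlier_lt earlier_le by auto
    have "card (earlier a) < card (earlier j)" unfolding ej by simp
    from less[OF this] obtain \<phi> M where dom: "dominates \<phi> M (K \<inter> earlier a) (earlier a) (r a)" by blast
    have sub: "earlier a \<subseteq> {..<n}" using earlier_lt by auto
    have "\<exists>\<psi>. dominates \<psi> M (K \<inter> earlier j) (earlier j) (r a)"
    proof (cases "a \<in> K")
      case True
      then have "K \<inter> earlier j = insert a (K \<inter> earlier a)" using ej by auto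
      then show ?thesis
        using dominates_insert_both[OF dom, of a] an(1) earlier_le sub by (auto simp: ej)
    next
      case False
      then have "K \<inter> earlier j = K \<inter> earlier a" using ej by auto
      then show ?thesis
        using dominates_insert_right[OF dom, of a] an(1) earlier_le sub by (auto simp: ej)
    qed
    then obtain \<psi> where dom': "dominates \<psi> M (K \<inter> earlier j) (earlier j) (r a)" by blast
    have "\<exists>M'. dominates \<psi> M' (K \<inter> earlier j) (earlier j) (r j)"
    proof (rule dominates_evolves[OF dom' _ _ _ an(2) assms])
      show "r i \<le> r a" if "i \<in> earlier j" for i using that ej earlier_le by auto
      show "alg.live w \<subseteq> earlier j" if "r a < w" "w < r j" for w
        using that by (auto simp: alg.live_iff earlier_def)
    qed (auto dest: earlier_lt)
    then show ?thesis by blast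
  qed
qed

text \<open>The jobs that truncation leaves unchanged in the optimum are matched, and
  \<open>dominates\<close> compares their volumes. The unmatched jobs are equally many on both sides
  and cost at most \<open>x\<close> each under SRPT.\<close>

lemma truncated_volume_le:
  assumes "2 \<le> s"
  shows "(\<Sum>i\<in>earlier j. min (alg.rem i (r j)) x) \<le> (\<Sum>i\<in>earlier j. min (opt.rem i (r j)) x)"
proof -
  \<comment> \<open>Choosing \<open>K\<close> like this, truncation at \<open>x\<close> makes every job outside \<open>K\<close> cost exactly \<open>x\<close> in the optimum.\<close>
  define K where "K = {i. opt.rem i (r j) < x}"
  define L where "L = K \<inter> earlier j"
  obtain \<phi> M where "dominates \<phi> M L (earlier j) (r j)"
    using ex_dominates_earlier[OF assms] unfolding L_def by blast
  note d = this[unfolded dominates_def]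
  have fin: "finite L" by (simp add: L_def)
  have card: "card (earlier j - \<phi> ` L) = card (earlier j - L)"
    using d fin by (simp add: card_Diff_subset card_image L_def)
  have "(\<Sum>i\<in>earlier j. min (alg.rem i (r j)) x)
      = (\<Sum>i\<in>earlier j - \<phi> ` L. min (alg.rem i (r j)) x) + (\<Sum>i\<in>\<phi> ` L. min (alg.rem i (r j)) x)"
    using d by (intro sum.subset_diff) auto
  also have "\<dots> \<le> (\<Sum>i\<in>earlier j - \<phi> ` L. x) + (\<Sum>i\<in>\<phi> ` L. alg.rem i (r j))"
    by (intro add_mono sum_mono) auto
  also have "(\<Sum>i\<in>\<phi> ` L. alg.rem i (r j)) = (\<Sum>i\<in>L. alg.rem (\<phi> i) (r j))"
    using d by (simp add: sum.reindex)
  also have "\<dots> \<le> (\<Sum>i\<in>L. opt.rem i (r j))"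
    using d by (smt (verit) mult_nonneg_nonneg of_nat_0_le_iff)
  also have "\<dots> = (\<Sum>i\<in>L. min (opt.rem i (r j)) x)"
    by (intro sum.cong) (auto simp: L_def K_def)
  also have "(\<Sum>i\<in>earlier j - \<phi> ` L. x) = (\<Sum>i\<in>earlier j - L. min (opt.rem i (r j)) x)"
  proof -
    have "(\<Sum>i\<in>earlier j - L. min (opt.rem i (r j)) x) = (\<Sum>i\<in>earlier j - L. x)"
      by (intro sum.cong) (auto simp: L_def K_def)
    then show ?thesis using card by simp
  qed
  also have "(\<Sum>i\<in>earlier j - L. min (opt.rem i (r j)) x) + (\<Sum>i\<in>L. min (opt.rem i (r j)) x)
      = (\<Sum>i\<in>earlier j. min (opt.rem i (r j)) x)"
    by (intro sum.subset_diff[symmetric]) (auto simp: L_def)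
  finally show ?thesis by simp
qed

end

section \<open>Comparison of the flow times\<close>


context srpt_and_optimum
begin

lemma others_eq: "j < n \<Longrightarrow> {..<n} - {j} = earlier j \<union> {i \<in> {..<n}. j \<in> earlier i}"
  using earlier_linear by (auto dest: earlier_lt)

lemma sum_others:
  fixes f :: "nat \<Rightarrow> real"
  assumes "j < n"
  shows "(\<Sum>i\<in>{..<n} - {j}. f i) = (\<Sum>i\<in>earlier j. f i) + (\<Sum>i\<in>{i \<in> {..<n}. j \<in> earlier i}. f i)"
  unfolding others_eq[OF assms] by (rule sum.union_disjoint) (auto dest: earlier_asym)

lemma sum_later_swap:
  fixes f :: "nat \<Rightarrow> nat \<Rightarrow> real"
  shows "(\<Sum>i<n. \<Sum>j\<in>{j \<in> {..<n}. i \<in> earlier j}. f i j) = (\<Sum>j<n. \<Sum>i\<in>earlier j. f i j)"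
proof -
  have "{i \<in> {..<n}. i \<in> earlier j} = earlier j" for j by (auto dest: earlier_lt)
  then show ?thesis
    using sum.swap_restrict[of "{..<n}" "{..<n}" f "\<lambda>i j. i \<in> earlier j"] by simp
qed

text \<open>Each unordered pair is collected at its later job, where both remaining times are
  compared.\<close>

lemma sum_ordered_pairs:
  fixes f :: "nat \<Rightarrow> nat \<Rightarrow> real"
  shows "(\<Sum>i<n. \<Sum>j\<in>{..<n} - {i}. f i j) = (\<Sum>j<n. \<Sum>i\<in>earlier j. f i j + f j i)"
proof -
  have "(\<Sum>i<n. \<Sum>j\<in>{..<n} - {i}. f i j)
      = (\<Sum>i<n. \<Sum>j\<in>earlier i. f i j) + (\<Sum>i<n. \<Sum>j\<in>{j \<in> {..<n}. i \<in> earlier j}. f i j)"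
    by (simp add: sum_others flip: sum.distrib)
  also have "(\<Sum>i<n. \<Sum>j\<in>{j \<in> {..<n}. i \<in> earlier j}. f i j) = (\<Sum>j<n. \<Sum>i\<in>earlier j. f i j)"
    by (rule sum_later_swap)
  finally show ?thesis by (simp add: sum.distrib)
qed

section \<open>Bounds when both schedules complete every job\<close>

context
  fixes C D :: "nat \<Rightarrow> real"
  assumes C: "\<And>i. i < n \<Longrightarrow> alg.completes i (C i)" and D: "\<And>i. i < n \<Longrightarrow> opt.completes i (D i)"
begin

lemma release_le: "i < n \<Longrightarrow> r i \<le> C i" "i < n \<Longrightarrow> r i \<le> D i"
  using C[of i] D[of i] by (simp_all add: alg.completes_def opt.completes_def)

lemma sum_p_le: "(\<Sum>i<n. p i) \<le> (\<Sum>i<n. D i - r i)"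
  using opt.p_le_flow[OF _ D] by (intro sum_mono) auto

text \<open>
  Of two jobs that overlap, the one completed first is finished while the other one is alive, and
  this work is charged to the latter.
\<close>

lemma sum_truncated_opt_le:
  "(\<Sum>j<n. \<Sum>i\<in>earlier j. min (opt.rem i (r j)) (p j)) \<le> real m * (\<Sum>j<n. D j - r j)"
proof -
  \<comment> \<open>One comparison is weak and the other strict, so that simultaneous completions
    are charged exactly once.\<close>
  define f where "f i j = (if D i \<le> D j then opt.work i (r j) (D j) else 0)" for i j
  define g where "g i j = (if D i < D j then opt.work i (r j) (D j) else 0)" for i j
  have "min (opt.rem i (r j)) (p j) \<le> f i j + g j i" if j: "j < n" "i \<in> earlier j" for i j
  proof (cases "D i \<le> D j")
    case True
    then show ?thesis
      using opt.work_until_completion[of i "D i" "r j" "D j"] D release_le(2)[of j] j earlier_lt[of i j]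
      by (simp add: f_def g_def)
  next
    case False
    have "p j = opt.work j (r j) (D j)"
      using opt.work_until_completion[of j "D j" "r j" "D j"] D release_le(2)[of j] j by simp
    also have "\<dots> \<le> opt.work j (r i) (D i)"
      using j earlier_le[of i j] False by (intro opt.work_mono) auto
    finally show ?thesis using False by (simp add: f_def g_def)
  qed
  then have "(\<Sum>j<n. \<Sum>i\<in>earlier j. min (opt.rem i (r j)) (p j)) \<le> (\<Sum>j<n. \<Sum>i\<in>earlier j. f i j + g j i)"
    by (intro sum_mono) auto
  also have "\<dots> = (\<Sum>j<n. (\<Sum>i\<in>earlier j. f i j) + (\<Sum>i\<in>{i \<in> {..<n}. j \<in> earlier i}. g i j))"
    using sum_later_swap[of "\<lambda>j i. g i j"] by (simp add: sum.distrib)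
  also have "\<dots> \<le> (\<Sum>j<n. real m * (D j - r j))"
  proof (rule sum_mono)
    fix j assume "j \<in> {..<n}"
    then have j: "j < n" by simp
    have "(\<Sum>i\<in>earlier j. f i j) + (\<Sum>i\<in>{i \<in> {..<n}. j \<in> earlier i}. g i j)
        \<le> (\<Sum>i\<in>earlier j. opt.work i (r j) (D j)) + (\<Sum>i\<in>{i \<in> {..<n}. j \<in> earlier i}. opt.work i (r j) (D j))"
      by (intro add_mono sum_mono) (auto simp: f_def g_def)
    also have "\<dots> = (\<Sum>i\<in>{..<n} - {j}. opt.work i (r j) (D j))" using sum_others[OF j] by simp
    also have "\<dots> \<le> real m * (D j - r j)"
      using opt.sum_work_le[of "{..<n} - {j}" "r j" "D j"] release_le(2)[OF j] by simp
    finally show "(\<Sum>i\<in>earlier j. f i j) + (\<Sum>i\<in>{i \<in> {..<n}. j \<in> earlier i}. g i j) \<le> real m * (D j - r j)" .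
  qed
  finally show ?thesis by (simp add: sum_distrib_left)
qed

text \<open>In the factor 2, one unit pays for the processing times and one for the pairwise
  delays.\<close>

lemma total_flow_le_fast:
  assumes "2 \<le> s"
  shows "s * (\<Sum>i<n. C i - r i) \<le> 2 * (\<Sum>i<n. D i - r i)"
proof -
  have "(\<Sum>i<n. s * real m * (C i - r i)) \<le> (\<Sum>i<n. real m * p i + (\<Sum>j\<in>{..<n} - {i}. alg.delay i (C i) j))"
    using alg.flow_le_delay C by (intro sum_mono) auto
  also have "\<dots> = real m * (\<Sum>i<n. p i) + (\<Sum>i<n. \<Sum>j\<in>{..<n} - {i}. alg.delay i (C i) j)"
    by (simp add: sum.distrib sum_distrib_left)
  also have "(\<Sum>i<n. \<Sum>j\<in>{..<n} - {i}. alg.delay i (C i) j)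
      = (\<Sum>j<n. \<Sum>i\<in>earlier j. alg.delay i (C i) j + alg.delay j (C j) i)"
    by (rule sum_ordered_pairs)
  also have "\<dots> \<le> (\<Sum>j<n. \<Sum>i\<in>earlier j. min (alg.rem i (r j)) (p j))"
  proof (intro sum_mono)
    fix j i assume ji: "j \<in> {..<n}" "i \<in> earlier j"
    then have "r j = max (r i) (r j)" using earlier_le[of i j] by simp
    then show "alg.delay i (C i) j + alg.delay j (C j) i \<le> min (alg.rem i (r j)) (p j)"
      using alg.delay_add_le[of i j "C i" "C j" "r j"] ji earlier_lt[of i j] C by simp
  qed
  also have "\<dots> \<le> (\<Sum>j<n. \<Sum>i\<in>earlier j. min (opt.rem i (r j)) (p j))"
    by (intro sum_mono truncated_volume_le assms)
  also have "\<dots> \<le> real m * (\<Sum>j<n. D j - r j)" by (rule sum_truncated_opt_le)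
  also have "real m * (\<Sum>i<n. p i) \<le> real m * (\<Sum>i<n. D i - r i)"
    using sum_p_le by (intro mult_left_mono) auto
  finally have "real m * (s * (\<Sum>i<n. C i - r i)) \<le> real m * (2 * (\<Sum>i<n. D i - r i))"
    by (simp add: sum_distrib_left mult_ac)
  then show ?thesis using alg.m_pos by simp
qed

text \<open>
  The jobs that may delay \<open>i\<close>.  Among those released before \<open>i\<close>, the selection is by their remaining time in the
  optimum, which is where \<open>small_volume_le\<close> moves the bound.
\<close>

definition charged :: "nat \<Rightarrow> nat set" where
  "charged i = {j \<in> earlier i. opt.rem j (r i) \<le> p i}
     \<union> {j \<in> {..<n}. i \<in> earlier j \<and> r j < C i \<and> p j \<le> alg.rem i (r j)}"

lemma charged_lt: "j \<in> charged i \<Longrightarrow> j < n"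
  by (auto simp: charged_def dest: earlier_lt)

text \<open>Of the term \<open>2 * m * p i\<close>, one half is the job's own processing and the
  other the error in \<open>small_volume_le\<close>. Passing from \<open>r i\<close> to
  \<open>C i\<close> in the optimum costs at most \<open>m * (C i - r i)\<close>, which turns
  \<open>s\<close> into \<open>s - 1\<close>.\<close>

lemma flow_le_charged:
  assumes i: "i < n" and "1 \<le> s"
  shows "(s - 1) * real m * (C i - r i) \<le> 2 * real m * p i + (\<Sum>j\<in>charged i. opt.rem j (C i))"
proof -
  define Q1 where "Q1 = {j \<in> earlier i. opt.rem j (r i) \<le> p i}"
  define Q2 where "Q2 = {j \<in> {..<n}. i \<in> earlier j \<and> r j < C i \<and> p j \<le> alg.rem i (r j)}"
  have Q: "charged i = Q1 \<union> Q2" "Q1 \<inter> Q2 = {}" "finite Q1" "finite Q2"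
    by (auto simp: charged_def Q1_def Q2_def dest: earlier_asym)
  have "(\<Sum>j\<in>earlier i. alg.delay i (C i) j)
      \<le> (\<Sum>j\<in>earlier i. if alg.rem j (r i) \<le> p i then alg.rem j (r i) else 0)"
  proof (rule sum_mono)
    fix j assume j: "j \<in> earlier i"
    then have "r i = max (r i) (r j)" using earlier_le[of j i] by simp
    then show "alg.delay i (C i) j \<le> (if alg.rem j (r i) \<le> p i then alg.rem j (r i) else 0)"
      using alg.delay_le[OF i _ C, of j "r i"] i earlier_lt[OF j] by simp
  qed
  also have "\<dots> = (\<Sum>j | j \<in> earlier i \<and> alg.rem j (r i) \<le> p i. alg.rem j (r i))"
    using sum.inter_filter[of "earlier i" "\<lambda>j. alg.rem j (r i)" "\<lambda>j. alg.rem j (r i) \<le> p i"] by simp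
  also have "\<dots> \<le> (\<Sum>j\<in>Q1. opt.rem j (r i)) + real m * p i"
    unfolding Q1_def
  proof (rule small_volume_le)
    show "earlier i \<subseteq> {..<n}" using earlier_lt by auto
    show "j \<in> earlier i" if "j < n" "r j < r i" for j using that by (simp add: earlier_def)
  qed (use \<open>1 \<le> s\<close> alg.p_pos[OF i] in \<open>simp_all add: earlier_le\<close>)
  finally have 1: "(\<Sum>j\<in>earlier i. alg.delay i (C i) j) \<le> \<dots>" .
  have "(\<Sum>j\<in>{j \<in> {..<n}. i \<in> earlier j}. alg.delay i (C i) j)
      \<le> (\<Sum>j\<in>{j \<in> {..<n}. i \<in> earlier j}. if r j < C i \<and> p j \<le> alg.rem i (r j) then p j else 0)"
  proof (rule sum_mono)
    fix j assume j: "j \<in> {j \<in> {..<n}. i \<in> earlier j}"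
    then have "r j = max (r i) (r j)" using earlier_le[of i j] by simp
    then show "alg.delay i (C i) j \<le> (if r j < C i \<and> p j \<le> alg.rem i (r j) then p j else 0)"
      using alg.delay_le[OF i _ C, of j "r j"] alg.delay_eq_0_if_late[of "C i" j i] i j
      by (auto split: if_splits)
  qed
  also have "\<dots> = (\<Sum>j | j \<in> {j \<in> {..<n}. i \<in> earlier j} \<and> r j < C i \<and> p j \<le> alg.rem i (r j). p j)"
    by (rule sum.inter_filter[symmetric]) simp
  also have "\<dots> = (\<Sum>j\<in>Q2. opt.rem j (r i))"
    by (rule sum.cong) (auto simp: Q2_def dest!: earlier_le intro: opt.rem_before[symmetric])
  finally have 2: "(\<Sum>j\<in>{j \<in> {..<n}. i \<in> earlier j}. alg.delay i (C i) j) \<le> \<dots>" .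
  have "(\<Sum>j\<in>charged i. opt.rem j (r i)) - (\<Sum>j\<in>charged i. opt.rem j (C i)) = (\<Sum>j\<in>charged i. opt.work j (r i) (C i))"
    unfolding sum_subtractf[symmetric]
    using opt.rem_diff release_le(1)[OF i] charged_lt by (intro sum.cong) auto
  also have "\<dots> \<le> real m * (C i - r i)"
    using opt.sum_work_le[of "charged i" "r i" "C i"] release_le(1)[OF i] charged_lt by auto
  finally have 3: "(\<Sum>j\<in>charged i. opt.rem j (r i)) - (\<Sum>j\<in>charged i. opt.rem j (C i)) \<le> real m * (C i - r i)" .
  have "(\<Sum>j\<in>charged i. opt.rem j (r i)) = (\<Sum>j\<in>Q1. opt.rem j (r i)) + (\<Sum>j\<in>Q2. opt.rem j (r i))"
    unfolding Q(1) using Q by (intro sum.union_disjoint) auto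
  then show ?thesis
    using 1 2 3 alg.flow_le_delay[OF i C[OF i]] sum_others[OF i, of "alg.delay i (C i)"]
    by (simp add: algebra_simps)
qed

text \<open>If \<open>j\<close> is unfinished in the optimum at \<open>C i\<close>, then all that
  SRPT does on \<open>i\<close> after both releases falls between \<open>r j\<close> and
  \<open>D j\<close>; since \<open>j\<close> is charged to \<open>i\<close>, this is at least the
  remainder of \<open>j\<close>.\<close>

lemma opt_rem_le_work:
  assumes i: "i < n" and j: "j \<in> charged i"
  shows "opt.rem j (C i) \<le> alg.work i (r j) (D j)"
proof (cases "D j \<le> C i")
  case True
  then show ?thesis using opt.rem_after[OF _ D] charged_lt[OF j] by simp
next
  case False
  have jn: "j < n" using charged_lt[OF j] .
  define a where "a = max (r i) (r j)"
  have "opt.rem j (C i) \<le> alg.rem i a \<and> a \<le> C i"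
  proof (cases "j \<in> earlier i")
    case True
    then have "a = r i" using earlier_le[of j i] by (simp add: a_def)
    moreover have "opt.rem j (r i) \<le> p i" using j True by (auto simp: charged_def dest: earlier_asym)
    ultimately show ?thesis
      using opt.rem_antimono[OF jn release_le(1)[OF i]] release_le(1)[OF i] by simp
  next
    case False
    then have "i \<in> earlier j" "r j < C i" "p j \<le> alg.rem i (r j)" using j by (auto simp: charged_def)
    moreover from this have "a = r j" using earlier_le[of i j] by (simp add: a_def)
    ultimately show ?thesis using opt.rem_le_p[OF jn, of "C i"] by simp
  qed
  moreover from this have "alg.rem i a = alg.work i a (C i)"
    using alg.work_until_completion[OF i C[OF i], of a "C i"] by simp
  moreover have "alg.work i a (C i) \<le> alg.work i (r j) (D j)"
    using False i by (intro alg.work_mono) (auto simp: a_def)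
  ultimately show ?thesis by simp
qed

text \<open>After exchanging the sums, the work charged to a fixed \<open>j\<close> is done by SRPT
  between \<open>r j\<close> and \<open>D j\<close>, hence at rate at most \<open>s * m\<close>.
  This gives the summand \<open>s\<close>; the processing times give the 2.\<close>

lemma total_flow_le_slow:
  assumes "1 \<le> s"
  shows "(s - 1) * (\<Sum>i<n. C i - r i) \<le> (2 + s) * (\<Sum>i<n. D i - r i)"
proof -
  have "(\<Sum>i<n. (s - 1) * real m * (C i - r i)) \<le> (\<Sum>i<n. 2 * real m * p i + (\<Sum>j\<in>charged i. opt.rem j (C i)))"
    using flow_le_charged assms by (intro sum_mono) auto
  also have "\<dots> = 2 * real m * (\<Sum>i<n. p i) + (\<Sum>i<n. \<Sum>j\<in>charged i. opt.rem j (C i))"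
    by (simp add: sum.distrib sum_distrib_left)
  also have "(\<Sum>i<n. \<Sum>j\<in>charged i. opt.rem j (C i)) \<le> (\<Sum>i<n. \<Sum>j\<in>charged i. alg.work i (r j) (D j))"
    by (intro sum_mono opt_rem_le_work) auto
  also have "\<dots> = (\<Sum>i<n. \<Sum>j\<in>{j \<in> {..<n}. j \<in> charged i}. alg.work i (r j) (D j))"
    using charged_lt by (intro sum.cong) auto
  also have "\<dots> = (\<Sum>j<n. \<Sum>i\<in>{i \<in> {..<n}. j \<in> charged i}. alg.work i (r j) (D j))"
    by (rule sum.swap_restrict) auto
  also have "\<dots> \<le> (\<Sum>j<n. s * real m * (D j - r j))"
    using release_le(2) by (intro sum_mono alg.sum_work_le) auto
  also have "2 * real m * (\<Sum>i<n. p i) \<le> 2 * real m * (\<Sum>i<n. D i - r i)"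
    using sum_p_le by (intro mult_left_mono) auto
  finally have "(s - 1) * real m * (\<Sum>i<n. C i - r i)
      \<le> 2 * real m * (\<Sum>i<n. D i - r i) + s * real m * (\<Sum>i<n. D i - r i)"
    by (simp flip: sum_distrib_left)
  then have "real m * ((s - 1) * (\<Sum>i<n. C i - r i)) \<le> real m * ((2 + s) * (\<Sum>i<n. D i - r i))"
    by (simp add: algebra_simps)
  then show ?thesis using alg.m_pos by simp
qed

text \<open>For \<open>s\<close> up to 2 the factor \<open>2 + s\<close> is at most 4; beyond that
  \<open>total_flow_le_fast\<close> is stronger than required.\<close>

lemma total_flow_le:
  assumes "1 < s"
  shows "(\<Sum>i<n. C i - r i) \<le> 4 / (s - 1) * (\<Sum>i<n. D i - r i)"
proof -
  have nonneg: "0 \<le> (\<Sum>i<n. D i - r i)" using release_le(2) by (intro sum_nonneg) auto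
  have nonneg': "0 \<le> (\<Sum>i<n. C i - r i)" using release_le(1) by (intro sum_nonneg) auto
  have "(s - 1) * (\<Sum>i<n. C i - r i) \<le> 4 * (\<Sum>i<n. D i - r i)"
  proof (cases "s \<le> 2")
    case True
    then have "(2 + s) * (\<Sum>i<n. D i - r i) \<le> 4 * (\<Sum>i<n. D i - r i)"
      using nonneg by (intro mult_right_mono) auto
    then show ?thesis using total_flow_le_slow assms by linarith
  next
    case False
    then have "s * (\<Sum>i<n. C i - r i) \<le> 2 * (\<Sum>i<n. D i - r i)" by (intro total_flow_le_fast) simp
    then show ?thesis using nonneg nonneg' by (simp add: algebra_simps)
  qed
  then show ?thesis using assms by (simp add: field_simps)
qed

end

text \<open>A competitor that leaves a job unfinished has infinite total flow time; otherwise all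
  completion times are real.\<close>

lemma ereal_total_flow_le:
  assumes "1 < s"
  shows "total_flow_time m s n r p S \<le> ereal (4 / (s - 1)) * total_flow_time m 1 n r p Q"
proof (cases "\<exists>i<n. completion_time m 1 r p Q i = \<infinity>")
  case True
  then have "\<exists>i\<in>{..<n}. completion_time m 1 r p Q i - ereal (r i) = \<infinity>" by force
  then have "total_flow_time m 1 n r p Q = \<infinity>"
    unfolding total_flow_time_def by (simp add: sum_Pinfty)
  then show ?thesis using assms by simp
next
  case False
  have "\<forall>i<n. \<exists>C. alg.completes i C \<and> completion_time m s r p S i = ereal C"
    using alg.ex_completes by blast
  then obtain C where C: "\<And>i. i < n \<Longrightarrow> alg.completes i (C i)"
      "\<And>i. i < n \<Longrightarrow> completion_time m s r p S i = ereal (C i)" by metis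
  have "\<forall>i<n. \<exists>D. opt.completes i D \<and> completion_time m 1 r p Q i = ereal D"
    using False opt.completion_time_finite by metis
  then obtain D where D: "\<And>i. i < n \<Longrightarrow> opt.completes i (D i)"
      "\<And>i. i < n \<Longrightarrow> completion_time m 1 r p Q i = ereal (D i)" by metis
  have "total_flow_time m s n r p S = ereal (\<Sum>i<n. C i - r i)"
    unfolding total_flow_time_def sum_ereal[symmetric] using C(2) by (intro sum.cong) auto
  moreover have "total_flow_time m 1 n r p Q = ereal (\<Sum>i<n. D i - r i)"
    unfolding total_flow_time_def sum_ereal[symmetric] using D(2) by (intro sum.cong) auto
  ultimately show ?thesis using total_flow_le[OF C(1) D(1) assms] by simp
qed

end

theorem theorem1:
  fixes m n :: nat and \<epsilon> :: real and r p :: "nat \<Rightarrow> real" and S :: schedule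
  assumes "m \<ge> 1" and "\<epsilon> > 0"
    and "is_instance n r p"
    and "srpt m (1 + \<epsilon>) n r p S"
  shows "total_flow_time m (1 + \<epsilon>) n r p S \<le> ereal (4 / \<epsilon>) * optimal_flow_time m n r p"
proof -
  define X where "X = total_flow_time m (1 + \<epsilon>) n r p S"
  \<comment> \<open>The constant is moved to the left so that the infimum over \<open>Q\<close> can
    be taken on the right.\<close>
  have "ereal (\<epsilon> / 4) * X \<le> total_flow_time m 1 n r p Q" if "feasible m 1 n r p Q" for Q
  proof -
    interpret srpt_and_optimum m n "1 + \<epsilon>" r p S Q
      using assms that by unfold_locales (auto simp: srpt_def)
    have "X \<le> ereal (4 / \<epsilon>) * total_flow_time m 1 n r p Q"
      using ereal_total_flow_le assms(2) by (simp add: X_def)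
    then have "ereal (\<epsilon> / 4) * X \<le> ereal (\<epsilon> / 4) * (ereal (4 / \<epsilon>) * total_flow_time m 1 n r p Q)"
      using assms(2) by (intro ereal_mult_left_mono) auto
    also have "\<dots> = total_flow_time m 1 n r p Q"
      using assms(2) by (simp add: mult.assoc[symmetric])
    finally show ?thesis .
  qed
  then have "ereal (\<epsilon> / 4) * X \<le> optimal_flow_time m n r p"
    unfolding optimal_flow_time_def by (intro INF_greatest) simp
  then have "ereal (4 / \<epsilon>) * (ereal (\<epsilon> / 4) * X) \<le> ereal (4 / \<epsilon>) * optimal_flow_time m n r p"
    using assms(2) by (intro ereal_mult_left_mono) auto
  moreover have "ereal (4 / \<epsilon>) * (ereal (\<epsilon> / 4) * X) = X"
    using assms(2) by (simp add: mult.assoc[symmetric])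
  ultimately show ?thesis by (simp add: X_def)
qed

end
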